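(* Let $\zeta$ be an aperiodic extremally permutative primitive constant-shape substitution on $\mathbb{Z}^d$ with supports $F_n$ of its iterates $\zeta^n$. Then the set of nondeterministic directions $\operatorname{ND}(X_\zeta,S,\mathbb{Z}^d)$ is the intersection of the unit sphere $\mathbb{S}^{d-1}$ with a nonempty union of limits of nested sequences of opposite normal cones of the form $\hat N_{G_n}(\operatorname{conv}(F_n))$, where $G_n$ is a face of $\operatorname{conv}(F_n)$, $n>0$. That is, there is a nonempty family $(C_i)_{i\in I}$ such that $\operatorname{ND}(X_\zeta,S,\mathbb{Z}^d)=\mathbb{S}^{d-1}\cap\bigcup_{i\in I}C_i$ and each $C_i$ is the intersection of a decreasing sequence of cones each of which has the form $\hat N_{G}(\operatorname{conv}(F_n))$ for some integer $n>0$ and some nonempty face $G$ of $\operatorname{conv}(F_n)$.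
   Context: Let $d\ge 1$; $\|\cdot\|$ is the Euclidean norm on $\mathbb{R}^d$ and the induced operator norm on matrices. For a finite alphabet $\mathcal{A}$, $\mathcal{A}^{\mathbb{Z}^d}$ carries the product topology and the shift action $(S^{n}x)_{k}=x_{n+k}$. A subshift is a closed shift-invariant subset; it is aperiodic if none of its points $x$ has a nonzero period (a $p\in\mathbb{Z}^d\setminus\{0\}$ with $x_{k+p}=x_k$ for all $k$). A pattern is an element of $\mathcal{A}^P$ with $P\subset\mathbb{Z}^d$ finite (identified up to translation of the support); it occurs in $x$ at $n$ if it equals $x|_{n+P}$. Constant-shape substitution: let $L$ be a $d\times d$ integer matrix with $\|L\|>1$, $\|L^{-1}\|<1$ (expansion matrix), and let $F_1\subset\mathbb{Z}^d$ be a set of representatives of $\mathbb{Z}^d/L(\mathbb{Z}^d)$ with $0\in F_1$ (support). A constant-shape substitution is a map $\zeta:\mathcal{A}\to\mathcal{A}^{F_1}$. Its iterates $\zeta^n:\mathcal{A}\to\mathcal{A}^{F_n}$ have expansion matrix $L^n$ and support $F_n$, where $F_{n+1}=F_1+L(F_n)$, and $\zeta^{n+1}(a)_{L(g)+f}=\zeta(\zeta^n(a)_g)_f$ for $g\in F_n,f\in F_1$. Standing assumption: $(F_n)_{n>0}$ is a Følner sequence, i.e. $|F_n\,\Delta\,(m+F_n)|/|F_n|\to0$ for every $m\in\mathbb{Z}^d$. $\zeta$ is primitive if for some $n>0$ every letter occurs in $\zeta^n(a)$ for every $a\in\mathcal{A}$. $X_\zeta$ is the subshift of all $x\in\mathcal{A}^{\mathbb{Z}^d}$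 such that every pattern occurring in $x$ occurs in some $\zeta^n(a)$, $n>0$, $a\in\mathcal{A}$. $\zeta$ is aperiodic if $X_\zeta$ is. Extremally permutative: for every extreme point $f$ of $\operatorname{conv}(F_1)$ the map $a\mapsto\zeta(a)_f$ is a bijection of $\mathcal{A}$. For $v\in\mathbb{S}^{d-1}$ let $H_v=\{x\in\mathbb{R}^d:\langle x,v\rangle<0\}$. $v$ is deterministic for a subshift $X$ if for all $x,y\in X$, $x|_{H_v\cap\mathbb{Z}^d}=y|_{H_v\cap\mathbb{Z}^d}$ implies $x=y$; otherwise $v$ is nondeterministic. $\operatorname{ND}(X,S,\mathbb{Z}^d)$ is the set of nondeterministic $v$. For a closed convex set $C\subseteq\mathbb{R}^d$ and a nonempty face $F$ of $C$, the opposite normal cone is $\hat N_F(C)=\{v\in\mathbb{R}^d:\min_{t\in C}\langle v,t\rangle=\langle v,p\rangle\ \forall p\in F\}$. *)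

theory Defs
  imports "HOL-Analysis.Analysis"
begin

(* The lattice Z^d is the type int^'d, embedded in R^d = real^'d by real_vec.  The finite
   alphabet is a type 'a of class finite. *)

definition real_vec :: "int^'d \<Rightarrow> real^'d" where
  "real_vec k = (\<chi> i. real_of_int (k $ i))"

abbreviation real_matrix :: "int^'d^'d \<Rightarrow> real^'d^'d" where
  "real_matrix L \<equiv> map_matrix real_of_int L"

type_synonym ('a, 'd) config = "int^'d \<Rightarrow> 'a"

(* A pattern in A^P is a partial map with domain P. *)
type_synonym ('a, 'd) pattern = "int^'d \<Rightarrow> 'a option"

(* q is an arbitrary partial map, so that this covers occurrences in another pattern as well
   as in a configuration x, represented by Some o x. *)
definition occurs_at ::
  "('a, 'd::finite) pattern \<Rightarrow> (int^'d \<Rightarrow> 'a option) \<Rightarrow> int^'d \<Rightarrow> bool" where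
  "occurs_at p q n \<longleftrightarrow> (\<forall>k\<in>dom p. q (n + k) = p k)"

definition is_period :: "('a, 'd::finite) config \<Rightarrow> int^'d \<Rightarrow> bool" where
  "is_period x p \<longleftrightarrow> (\<forall>k. x (k + p) = x k)"

definition aperiodic :: "('a, 'd::finite) config set \<Rightarrow> bool" where
  "aperiodic X \<longleftrightarrow> (\<forall>x\<in>X. \<not> (\<exists>p. p \<noteq> 0 \<and> is_period x p))"


section \<open>Constant-shape substitutions\<close>

definition expansion_matrix :: "int^'d^'d \<Rightarrow> bool" where
  "expansion_matrix L \<longleftrightarrow>
     onorm ((*v) (real_matrix L)) > 1 \<and>
     invertible (real_matrix L) \<and>
     onorm ((*v) (matrix_inv (real_matrix L))) < 1"

definition representatives :: "int^'d^'d \<Rightarrow> (int^'d) set \<Rightarrow> bool" where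
  "representatives L F \<longleftrightarrow> (\<forall>k. \<exists>!f. f \<in> F \<and> k - f \<in> range ((*v) L))"

definition constant_shape_substitution ::
  "int^'d^'d \<Rightarrow> (int^'d) set \<Rightarrow> ('a \<Rightarrow> ('a, 'd) pattern) \<Rightarrow> bool" where
  "constant_shape_substitution L F1 \<zeta> \<longleftrightarrow>
     expansion_matrix L \<and> representatives L F1 \<and> 0 \<in> F1 \<and> (\<forall>a. dom (\<zeta> a) = F1)"

primrec supports :: "int^'d^'d \<Rightarrow> (int^'d) set \<Rightarrow> nat \<Rightarrow> (int^'d) set" where
  "supports L F1 0 = {0}"
| "supports L F1 (Suc n) = {f + L *v g | f g. f \<in> F1 \<and> g \<in> supports L F1 n}"

(* Every k has a unique decomposition k = L g + f with f in F1; remainder and quotient are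
   f and g. *)
definition remainder :: "int^'d^'d \<Rightarrow> (int^'d) set \<Rightarrow> int^'d \<Rightarrow> int^'d" where
  "remainder L F1 k = (THE f. f \<in> F1 \<and> k - f \<in> range ((*v) L))"

definition quotient :: "int^'d^'d \<Rightarrow> (int^'d) set \<Rightarrow> int^'d \<Rightarrow> int^'d" where
  "quotient L F1 k = (THE g. k = L *v g + remainder L F1 k)"

(* The n-th iterate of the substitution.  The lemmas dom_iterate and iterate_Suc_decomposition
   below show that its support is supports L F1 n and that it satisfies the usual recursion. *)
primrec iterate ::
  "int^'d^'d \<Rightarrow> (int^'d) set \<Rightarrow> ('a \<Rightarrow> ('a, 'd) pattern) \<Rightarrow> nat \<Rightarrow> 'a \<Rightarrow> ('a, 'd) pattern" where
  "iterate L F1 \<zeta> 0 a = [0 \<mapsto> a]"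
| "iterate L F1 \<zeta> (Suc n) a =
     (\<lambda>k. case iterate L F1 \<zeta> n a (quotient L F1 k) of
            None \<Rightarrow> None
          | Some b \<Rightarrow> \<zeta> b (remainder L F1 k))"

definition folner :: "(nat \<Rightarrow> (int^'d::finite) set) \<Rightarrow> bool" where
  "folner F \<longleftrightarrow>
     (\<forall>m. (\<lambda>n. real (card (sym_diff (F n) ((\<lambda>k. m + k) ` F n))) / real (card (F n)))
            \<longlonglongrightarrow> 0)"

definition primitive ::
  "int^'d^'d \<Rightarrow> (int^'d) set \<Rightarrow> ('a \<Rightarrow> ('a, 'd) pattern) \<Rightarrow> bool" where
  "primitive L F1 \<zeta> \<longleftrightarrow> (\<exists>n>0. \<forall>a b. b \<in> ran (iterate L F1 \<zeta> n a))"

definition subst_subshift ::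
  "int^'d^'d \<Rightarrow> (int^'d) set \<Rightarrow> ('a \<Rightarrow> ('a, 'd) pattern) \<Rightarrow> ('a, 'd) config set" where
  "subst_subshift L F1 \<zeta> =
     {x. \<forall>p. finite (dom p) \<and> (\<exists>k. occurs_at p (Some \<circ> x) k) \<longrightarrow>
           (\<exists>n>0. \<exists>a k. occurs_at p (iterate L F1 \<zeta> n a) k)}"

definition extremally_permutative ::
  "(int^'d) set \<Rightarrow> ('a \<Rightarrow> ('a, 'd::finite) pattern) \<Rightarrow> bool" where
  "extremally_permutative F1 \<zeta> \<longleftrightarrow>
     (\<forall>f\<in>F1. real_vec f extreme_point_of (convex hull (real_vec ` F1)) \<longrightarrow>
        bij (\<lambda>a. the (\<zeta> a f)))"


section \<open>Nondeterministic directions and opposite normal cones\<close>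

definition open_half_space :: "real^'d \<Rightarrow> (real^'d) set" where
  "open_half_space v = {x. x \<bullet> v < 0}"

definition deterministic :: "('a, 'd::finite) config set \<Rightarrow> real^'d \<Rightarrow> bool" where
  "deterministic X v \<longleftrightarrow>
     (\<forall>x\<in>X. \<forall>y\<in>X. (\<forall>k. real_vec k \<in> open_half_space v \<longrightarrow> x k = y k) \<longrightarrow> x = y)"

definition ND :: "('a, 'd::finite) config set \<Rightarrow> (real^'d) set" where
  "ND X = {v \<in> sphere 0 1. \<not> deterministic X v}"

definition opposite_normal_cone :: "(real^'d) set \<Rightarrow> (real^'d) set \<Rightarrow> (real^'d) set" where
  "opposite_normal_cone C G = {v. \<forall>p\<in>G. is_arg_min (\<lambda>t. v \<bullet> t) (\<lambda>t. t \<in> C) p}"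


section \<open>Iterates\<close>

lemma real_matrix_mult_real_vec: "real_matrix L *v real_vec g = real_vec (L *v g)"
  by (simp add: vec_eq_iff real_vec_def matrix_vector_mult_def)

lemma inj_expansion_matrix:
  assumes "expansion_matrix L"
  shows "inj ((*v) L)"
proof (rule injI)
  fix g h assume "L *v g = L *v h"
  then have "real_matrix L *v real_vec g = real_matrix L *v real_vec h"
    by (simp add: real_matrix_mult_real_vec)
  moreover have "inj ((*v) (real_matrix L))"
    using assms inj_matrix_vector_mult unfolding expansion_matrix_def by blast
  ultimately have "real_vec g = real_vec h"
    by (auto dest: injD)
  then show "g = h"
    by (simp add: vec_eq_iff real_vec_def)
qed

lemma remainder_eq:
  assumes "constant_shape_substitution L F1 \<zeta>" "f \<in> F1"
  shows "remainder L F1 (L *v g + f) = f"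
  unfolding remainder_def
proof (rule the1_equality)
  show "\<exists>!f'. f' \<in> F1 \<and> L *v g + f - f' \<in> range ((*v) L)"
    using assms unfolding constant_shape_substitution_def representatives_def by blast
qed (use assms in auto)

lemma quotient_eq:
  assumes "constant_shape_substitution L F1 \<zeta>" "f \<in> F1"
  shows "quotient L F1 (L *v g + f) = g"
  using assms inj_expansion_matrix[of L]
  unfolding quotient_def remainder_eq[OF assms] constant_shape_substitution_def
  by (auto dest: injD)

lemma decomposition:
  assumes "constant_shape_substitution L F1 \<zeta>"
  obtains f g where "f \<in> F1" "k = L *v g + f"
proof -
  obtain f g where "f \<in> F1" "k - f = L *v g"
    using assms unfolding constant_shape_substitution_def representatives_def by blast
  then show thesis
    using that by (metis diff_add_cancel)
qed

lemma iterate_Suc_decomposition: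
  assumes "constant_shape_substitution L F1 \<zeta>" "f \<in> F1" "iterate L F1 \<zeta> n a g = Some b"
  shows "iterate L F1 \<zeta> (Suc n) a (L *v g + f) = \<zeta> b f"
  using assms(3) by (simp add: remainder_eq[OF assms(1,2)] quotient_eq[OF assms(1,2)])

lemma dom_iterate:
  assumes "constant_shape_substitution L F1 \<zeta>"
  shows "dom (iterate L F1 \<zeta> n a) = supports L F1 n"
proof (induction n)
  case 0
  show ?case by (auto split: if_splits)
next
  case (Suc n)
  have "k \<in> dom (iterate L F1 \<zeta> (Suc n) a) \<longleftrightarrow> k \<in> supports L F1 (Suc n)" for k
  proof -
    obtain f g where fg: "f \<in> F1" "k = L *v g + f"
      using decomposition[OF assms] .
    have rq: "remainder L F1 k = f" "quotient L F1 k = g"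
      using fg remainder_eq[OF assms] quotient_eq[OF assms] by auto
    have "k \<in> dom (iterate L F1 \<zeta> (Suc n) a) \<longleftrightarrow> g \<in> dom (iterate L F1 \<zeta> n a)"
      using assms fg(1) unfolding constant_shape_substitution_def
      by (auto simp: rq dom_def split: option.splits)
    also have "\<dots> \<longleftrightarrow> k \<in> supports L F1 (Suc n)"
    proof
      assume "g \<in> dom (iterate L F1 \<zeta> n a)"
      then show "k \<in> supports L F1 (Suc n)"
        using Suc fg by (auto simp: add.commute)
    next
      assume "k \<in> supports L F1 (Suc n)"
      then obtain f' g' where "f' \<in> F1" "g' \<in> supports L F1 n" "k = L *v g' + f'"
        by (auto simp: add.commute)
      then show "g \<in> dom (iterate L F1 \<zeta> n a)"
        using Suc rq(2) quotient_eq[OF assms] by auto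
    qed
    finally show ?thesis .
  qed
  then show ?case by blast
qed

lemma iterate_1:
  assumes "constant_shape_substitution L F1 \<zeta>"
  shows "iterate L F1 \<zeta> 1 a = \<zeta> a"
proof
  fix k
  obtain f g where fg: "f \<in> F1" "k = L *v g + f"
    using decomposition[OF assms] .
  show "iterate L F1 \<zeta> 1 a k = \<zeta> a k"
  proof (cases "g = 0")
    case True
    then show ?thesis
      using iterate_Suc_decomposition[OF assms fg(1), where n = 0 and a = a and g = g] fg(2)
      by simp
  next
    case False
    have "k \<notin> F1"
      using False fg(2) quotient_eq[OF assms, of k 0] quotient_eq[OF assms fg(1), of g] by auto
    moreover have "dom (\<zeta> a) = F1"
      using assms unfolding constant_shape_substitution_def by blast
    ultimately show ?thesis
      using False quotient_eq[OF assms fg(1), of g] fg(2) by auto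
  qed
qed

end

theory Submission
  imports Defs "HOL-Library.Diagonal_Subsequence"
begin

text \<open>The normal fan of \<open>conv (F\<^sub>n)\<close> is the common refinement of the pullbacks under \<open>L\<^sup>0, \<dots>, L\<^sup>n\<^sup>-\<^sup>1\<close>
  of the normal fan of \<open>conv (F\<^sub>1)\<close>, so the opposite normal cones of the faces on which a direction
  \<open>v\<close> is minimal decrease in \<open>n\<close>. The point is that their intersection \<open>C(v)\<close> consists of
  nondeterministic directions whenever \<open>v\<close> is nondeterministic; \<open>{0}\<close> is added to the family
  so that it is nonempty for trivial reasons.

  Let \<open>x\<close> and \<open>y\<close> differ at the origin and only on \<open>{v \<ge> 0}\<close>. Recognizability and permutativity at
  the vertices of \<open>conv (F\<^sub>1)\<close> allow one to desubstitute \<open>x\<close> and \<open>y\<close> simultaneously and forever, always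
  at an offset \<open>f\<^sub>n \<in> F\<^sub>1\<close> that is minimal for \<open>v\<^sub>n = (L\<^sup>T)\<^sup>n v\<close>, hence also for \<open>w\<^sub>n = (L\<^sup>T)\<^sup>n w\<close> if
  \<open>w \<in> C(v)\<close>. A position \<open>p\<close> where \<open>x\<close> and \<open>y\<close> differ has ancestors \<open>g\<^sub>n\<close>, which stay in a finite set, and
  both \<open>\<langle>g\<^sub>n, v\<^sub>n\<rangle> \<ge> 0\<close> and \<open>\<langle>g\<^sub>n, w\<^sub>n\<rangle>\<close> are nonincreasing. A bounded sequence of this kind has to vanish
  somewhere, because \<open>L\<close> is expanding; by van der Waerden's theorem the \<open>g\<^sub>n\<close> may be assumed to be constant along
  long arithmetic progressions. Applied to \<open>v\<close>, and then to \<open>w\<close>, for which the sequence is constant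
  from there on, this gives \<open>\<langle>p, w\<rangle> \<ge> 0\<close>.\<close>

section \<open>Arithmetic progressions in finite colourings\<close>

lemma block_eq:
  assumes "map c [a * B..<a * B + B] = map c [b * B..<b * B + B]" "j < (B::nat)"
  shows "c (j + a * B) = c (j + b * B)"
proof -
  have "map c [a * B..<a * B + B] ! j = map c [b * B..<b * B + B] ! j"
    using assms(1) by simp
  then show ?thesis using assms(2) by (simp add: add.commute)
qed

text \<open>Colour focusing: either there is a progression of length \<open>l + 1\<close>, or there are \<open>s\<close>
  progressions of length \<open>l\<close> of pairwise distinct colours whose next terms coincide.\<close>

lemma colour_focusing:
  fixes l r s :: nat
  assumes vdW: "\<And>r. \<exists>W. \<forall>c::nat \<Rightarrow> nat. finite (range c) \<and> card (range c) \<le> r \<longrightarrow>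
     (\<exists>a d. 0 < d \<and> d \<le> W \<and> a + l * d \<le> W \<and> (\<forall>i<l. c (a + i * d) = c a))"
  shows "\<exists>W. \<forall>c::nat \<Rightarrow> nat. finite (range c) \<and> card (range c) \<le> r \<longrightarrow>
     (\<exists>a d. 0 < d \<and> a + Suc l * d \<le> W \<and> (\<forall>i<Suc l. c (a + i * d) = c a)) \<or>
     (\<exists>f\<le>W. \<exists>A D. (\<forall>j<s. 0 < D j \<and> D j \<le> W \<and> A j + l * D j = f \<and> (\<forall>i<l. c (A j + i * D j) = c (A j))) \<and>
        inj_on (\<lambda>j. c (A j)) {..<s})"
proof (induction s)
  case 0
  show ?case by auto
next
  case (Suc s)
  then obtain W where W: "\<And>c::nat \<Rightarrow> nat. finite (range c) \<Longrightarrow> card (range c) \<le> r \<Longrightarrow>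
   (\<exists>a d. 0 < d \<and> a + Suc l * d \<le> W \<and> (\<forall>i<Suc l. c (a + i * d) = c a)) \<or>
   (\<exists>f\<le>W. \<exists>A D. (\<forall>j<s. 0 < D j \<and> D j \<le> W \<and> A j + l * D j = f \<and> (\<forall>i<l. c (A j + i * D j) = c (A j))) \<and>
      inj_on (\<lambda>j. c (A j)) {..<s})"
    by blast
  \<comment> \<open>Colouring blocks of length \<open>B\<close> by their content uses at most
    \<open>r ^ B\<close> colours. A focus is at most \<open>W\<close>, so it lies, with all terms of
    the progressions before it, within one block length.\<close>
  define B where "B = Suc (W + W)"
  obtain V where V: "\<And>c::nat \<Rightarrow> nat. finite (range c) \<Longrightarrow> card (range c) \<le> r ^ B \<Longrightarrow>
   (\<exists>a d. 0 < d \<and> d \<le> V \<and> a + l * d \<le> V \<and> (\<forall>i<l. c (a + i * d) = c a))"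
    using vdW[of "r ^ B"] by blast
  show ?case
  proof (intro exI[of _ "Suc V * B + W"] allI impI)
    fix c :: "nat \<Rightarrow> nat"
    assume c: "finite (range c) \<and> card (range c) \<le> r"
    define b where "b n = to_nat (map c [n * B..<n * B + B])" for n
    have sub: "range b \<subseteq> to_nat ` {xs. set xs \<subseteq> range c \<and> length xs = B}"
      unfolding b_def by (auto intro!: imageI)
    have fin: "finite {xs. set xs \<subseteq> range c \<and> length xs = B}"
      using c by (intro finite_lists_length_eq) auto
    have "card (range b) \<le> card {xs. set xs \<subseteq> range c \<and> length xs = B}"
      using sub fin by (meson card_image_le card_mono finite_imageI le_trans)
    also have "\<dots> \<le> r ^ B"
      using c by (simp add: card_lists_length_eq power_mono)
    finally have card_b: "card (range b) \<le> r ^ B" .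
    have "finite (range b)"
      using sub fin by (meson finite_imageI finite_subset)
    from V[OF this card_b] obtain a d where ad: "0 < d" "d \<le> V" "a + l * d \<le> V" "\<forall>i<l. b (a + i * d) = b a"
      by blast
    have eq: "c (j + (a + i * d) * B) = c (j + a * B)" if "i < l" "j < B" for i j
      using ad(4) that by (intro block_eq) (auto simp: b_def)
    define c' where "c' j = c (j + a * B)" for j
    have sub': "range c' \<subseteq> range c" by (auto simp: c'_def)
    then have c': "finite (range c')" "card (range c') \<le> r"
      using c by (auto intro: finite_subset order.trans[OF card_mono])
    have aV: "a * B \<le> V * B" using ad(3) by (intro mult_right_mono) auto
    have dB: "d * B \<le> V * B" using ad(2) by (intro mult_right_mono) auto
    show "(\<exists>a d. 0 < d \<and> a + Suc l * d \<le> Suc V * B + W \<and> (\<forall>i<Suc l. c (a + i * d) = c a)) \<or>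
     (\<exists>f\<le>Suc V * B + W. \<exists>A D. (\<forall>j<Suc s. 0 < D j \<and> D j \<le> Suc V * B + W \<and> A j + l * D j = f \<and>
        (\<forall>i<l. c (A j + i * D j) = c (A j))) \<and> inj_on (\<lambda>j. c (A j)) {..<Suc s})"
      (is "?long \<or> ?focused")
    proof (rule disjCI)
      assume short: "\<not> ?focused"
      show ?long
      proof (rule ccontr)
        assume nlong: "\<not> ?long"
        have nlong': "\<not> (0 < d \<and> a' + Suc l * d \<le> B + W \<and> (\<forall>i<Suc l. c' (a' + i * d) = c' a'))" for a' d
        proof
          assume h: "0 < d \<and> a' + Suc l * d \<le> B + W \<and> (\<forall>i<Suc l. c' (a' + i * d) = c' a')"
          then have "(a' + a * B) + Suc l * d \<le> Suc V * B + W"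
            using aV unfolding mult_Suc by linarith
          moreover have "\<forall>i<Suc l. c ((a' + a * B) + i * d) = c (a' + a * B)"
            using h by (simp add: c'_def add_ac)
          ultimately show False using nlong h by blast
        qed
        have "\<not> (\<exists>a d. 0 < d \<and> a + Suc l * d \<le> W \<and> (\<forall>i<Suc l. c' (a + i * d) = c' a))"
          using nlong' by (meson le_add2 le_trans)
        then obtain f A D where f: "f \<le> W"
          and AD: "\<And>j. j < s \<Longrightarrow> 0 < D j \<and> D j \<le> W \<and> A j + l * D j = f \<and> (\<forall>i<l. c' (A j + i * D j) = c' (A j))"
          and inj: "inj_on (\<lambda>j. c' (A j)) {..<s}"
          using W[OF c'] by blast
        \<comment> \<open>If the focus had the colour of one of the progressions, it would extend
          that progression to length \<open>l + 1\<close>.\<close>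
        have new: "c' f \<noteq> c' (A j)" if "j < s" for j
        proof
          assume e: "c' f = c' (A j)"
          have "\<forall>i<Suc l. c' (A j + i * D j) = c' (A j)"
            using AD[OF that] e by (auto simp: less_Suc_eq)
          moreover have "A j + Suc l * D j \<le> B + W"
            using AD[OF that] f by (simp add: B_def)
          ultimately show False using nlong' AD[OF that] by blast
        qed
        \<comment> \<open>Adding \<open>d * B\<close> to every difference keeps the colours, because
          the blocks \<open>a + i * d\<close> with \<open>i < l\<close> have the same content. The
          old focus starts one more progression, of difference \<open>d * B\<close>, and the common
          next term becomes \<open>f + (a + l * d) * B\<close>.\<close>
        define A' where "A' j = (if j < s then A j else f) + a * B" for j
        define D' where "D' j = (if j < s then D j else 0) + d * B" for j
        have "0 < D' j \<and> D' j \<le> Suc V * B + W \<and> A' j + l * D' j = f + (a + l * d) * B \<and>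
           (\<forall>i<l. c (A' j + i * D' j) = c (A' j))" if "j < Suc s" for j
        proof (intro conjI allI impI)
          show "0 < D' j" using ad by (simp add: D'_def B_def)
          show "D' j \<le> Suc V * B + W"
          proof -
            have "(if j < s then D j else 0) \<le> W" using AD[of j] by simp
            then have "D' j \<le> W + V * B" unfolding D'_def using dB by (rule add_mono)
            then show ?thesis by simp
          qed
          show "A' j + l * D' j = f + (a + l * d) * B"
            using AD[of j] by (auto simp: A'_def D'_def algebra_simps)
          fix i assume i: "i < l"
          define t where "t = (if j < s then A j + i * D j else f)"
          have "A' j + i * D' j = t + (a + i * d) * B"
            by (auto simp: A'_def D'_def t_def algebra_simps)
          moreover have "t \<le> f"
            using AD[of j] mult_right_mono[of i l "D j"] i unfolding t_def by auto
          moreover have "f < B" using f by (simp add: B_def)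
          ultimately have "c (A' j + i * D' j) = c (t + a * B)" using eq[OF i, of t] by simp
          then show "c (A' j + i * D' j) = c (A' j)"
            using AD[of j] i by (auto simp: t_def A'_def c'_def)
        qed
        moreover have "inj_on (\<lambda>j. c (A' j)) {..<Suc s}"
        proof -
          have "c (A' j) = (if j < s then c' (A j) else c' f)" for j
            by (simp add: A'_def c'_def)
          then show ?thesis
            using inj new by (force simp: inj_on_def less_Suc_eq)
        qed
        moreover have "f + (a + l * d) * B \<le> Suc V * B + W"
          using f mult_right_mono[OF ad(3), of B] unfolding mult_Suc by linarith
        ultimately show False using short by blast
      qed
    qed
  qed
qed

text \<open>With \<open>r\<close> colours there are no \<open>r + 1\<close> focused progressions of
  distinct colours, so only the first alternative of \<open>colour_focusing\<close> remains. The
  bound on \<open>a + l * d\<close> concerns the term after the last one, which is where the focus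
  lies in the induction.\<close>

theorem van_der_Waerden:
  "\<exists>W. \<forall>c::nat \<Rightarrow> nat. finite (range c) \<and> card (range c) \<le> r \<longrightarrow>
     (\<exists>a d. 0 < d \<and> d \<le> W \<and> a + l * d \<le> W \<and> (\<forall>i<l. c (a + i * d) = c a))"
proof (induction l arbitrary: r)
  case 0
  show ?case by (intro exI[of _ 1]) auto
next
  case (Suc l)
  from colour_focusing[OF Suc.IH, of r "Suc r"] obtain W where W: "\<forall>c::nat \<Rightarrow> nat.
    finite (range c) \<and> card (range c) \<le> r \<longrightarrow>
     (\<exists>a d. 0 < d \<and> a + Suc l * d \<le> W \<and> (\<forall>i<Suc l. c (a + i * d) = c a)) \<or>
     (\<exists>f\<le>W. \<exists>A D. (\<forall>j<Suc r. 0 < D j \<and> D j \<le> W \<and> A j + l * D j = f \<and>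
        (\<forall>i<l. c (A j + i * D j) = c (A j))) \<and> inj_on (\<lambda>j. c (A j)) {..<Suc r})" ..
  show ?case
  proof (rule exI[of _ W], intro allI impI)
    fix c :: "nat \<Rightarrow> nat"
    assume c: "finite (range c) \<and> card (range c) \<le> r"
    have "\<not> inj_on (\<lambda>j. c (A j)) {..<Suc r}" for A
      using card_inj_on_le[of "\<lambda>j. c (A j)" "{..<Suc r}" "range c"] c by auto
    then obtain a d where "0 < d" "a + Suc l * d \<le> W" "\<forall>i<Suc l. c (a + i * d) = c a"
      using W[rule_format, OF c] by meson
    moreover from this have "d \<le> W" by simp
    ultimately show "\<exists>a d. 0 < d \<and> d \<le> W \<and> a + Suc l * d \<le> W \<and> (\<forall>i<Suc l. c (a + i * d) = c a)"
      by blast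
  qed
qed

section \<open>Bounded orbits of functionals under an expansion\<close>

text \<open>The Gram operator \<open>G\<close> is injective on \<open>span S\<close>, hence a
  bijection of it with bounded inverse, and \<open>\<phi> (G x)\<close> is a combination of the
  values of \<open>\<phi>\<close> on \<open>S\<close>. The constant \<open>K\<close> depends on
  \<open>S\<close> alone, so the functional may vary with time.\<close>

lemma bounded_on_span:
  fixes S :: "'v::euclidean_space set"
  assumes "finite S"
  shows "\<exists>K. \<forall>(\<phi>::'v \<Rightarrow> real) C b. linear \<phi> \<and> (\<forall>u\<in>S. \<bar>\<phi> u\<bar> \<le> C) \<and> b \<in> span S \<longrightarrow> \<bar>\<phi> b\<bar> \<le> C * K * norm b"
proof -
  define G where "G x = (\<Sum>u\<in>S. (u \<bullet> x) *\<^sub>R u)" for x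
  have linG: "linear G"
    unfolding G_def by (intro linear_compose_sum ballI) (auto intro!: linearI simp: inner_add_right scaleR_left_distrib)
  have GS: "G x \<in> span S" for x
    unfolding G_def by (intro span_sum span_scale span_base)
  have ker: "x = 0" if "x \<in> span S" "G x = 0" for x
  proof -
    have "0 = G x \<bullet> x" using that by simp
    also have "\<dots> = (\<Sum>u\<in>S. (u \<bullet> x)\<^sup>2)"
      by (simp add: G_def inner_sum_left power2_eq_square)
    finally have "\<forall>u\<in>S. (u \<bullet> x)\<^sup>2 = 0"
      using assms sum_nonneg_eq_0_iff[of S "\<lambda>u. (u \<bullet> x)\<^sup>2"] by simp
    then have "\<forall>u\<in>S. orthogonal x u" by (simp add: orthogonal_def inner_commute)
    then have "orthogonal x x"
      using that(1) orthogonal_to_span by blast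
    then show ?thesis by (simp add: orthogonal_self)
  qed
  obtain e where e: "e > 0" "\<forall>x\<in>span S. norm (G x) \<ge> e * norm x"
    using injective_imp_isometric[of "span S" G] ker linG closed_subspace
    by (auto simp: linear_conv_bounded_linear)
  have "inj_on G (span S)"
    using linG ker by (subst linear_injective_on_subspace_0) auto
  then have "dim (G ` span S) = dim (span S)"
    using dim_image_eq[OF linG, of "span S"] by (simp add: span_span)
  then have surj: "G ` span S = span S"
    using GS linG by (intro subspace_dim_equal) (auto intro: linear_subspace_image)
  define K where "K = (\<Sum>u\<in>S. norm u) / e"
  have "\<bar>\<phi> b\<bar> \<le> C * K * norm b"
    if \<phi>: "linear \<phi>" "\<forall>u\<in>S. \<bar>\<phi> u\<bar> \<le> C" and b: "b \<in> span S" for \<phi> :: "'v \<Rightarrow> real" and C b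
  proof -
    obtain x where x: "x \<in> span S" "b = G x" using surj b by blast
    have "norm x \<le> norm b / e" using e x by (simp add: field_simps)
    have "\<phi> b = (\<Sum>u\<in>S. (u \<bullet> x) * \<phi> u)"
      using \<phi>(1) by (simp add: x(2) G_def linear_sum linear_cmul)
    also have "\<bar>\<dots>\<bar> \<le> (\<Sum>u\<in>S. (norm u * norm x) * C)"
      using \<phi>(2) by (intro order.trans[OF sum_abs] sum_mono)
        (auto simp: abs_mult intro!: mult_mono Cauchy_Schwarz_ineq2)
    also have "\<dots> = (\<Sum>u\<in>S. norm u * C) * norm x"
      by (simp add: sum_distrib_right sum_distrib_left mult_ac)
    also have "\<dots> \<le> (\<Sum>u\<in>S. norm u * C) * (norm b / e)"
    proof (cases "S = {}")
      case False
      then have "C \<ge> 0" using \<phi>(2) by (metis abs_ge_zero all_not_in_conv order.trans)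
      then show ?thesis using \<open>norm x \<le> norm b / e\<close> by (intro mult_left_mono sum_nonneg) auto
    qed simp
    also have "\<dots> = C * K * norm b"
      by (simp add: K_def sum_distrib_right[symmetric])
    finally show ?thesis .
  qed
  then show ?thesis by blast
qed


text \<open>The first orbit vector that depends on its predecessors has an index at most the
  dimension. The span of these predecessors is mapped into itself, and onto itself by
  injectivity.\<close>

lemma orbit_span_invariant:
  fixes T :: "'v::euclidean_space \<Rightarrow> 'v"
  assumes T: "linear T" "inj T"
  obtains k where "0 < k" "k \<le> Suc DIM('v)"
    "T ` span ((\<lambda>i. (T ^^ i) z) ` {..<k}) = span ((\<lambda>i. (T ^^ i) z) ` {..<k})"
proof -
  define u where "u i = (T ^^ i) z" for i
  have "\<exists>k\<le>DIM('v). u k \<in> span (u ` {..<k})"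
  proof (rule ccontr)
    assume none: "\<not> ?thesis"
    have "independent (u ` {..<k}) \<and> card (u ` {..<k}) = k" if "k \<le> Suc DIM('v)" for k
      using that
    proof (induction k)
      case 0
      show ?case by (simp add: independent_empty)
    next
      case (Suc k)
      have notin: "u k \<notin> span (u ` {..<k})" using none Suc.prems by (meson Suc_le_mono)
      then have "u k \<notin> u ` {..<k}" by (rule contra_subsetD[OF span_superset])
      then show ?case
        using Suc notin by (simp add: lessThan_Suc independent_insert)
    qed
    from this[of "Suc DIM('v)"] show False
      using independent_bound[of "u ` {..<Suc DIM('v)}"] by auto
  qed
  then obtain k where k: "k \<le> DIM('v)" "u k \<in> span (u ` {..<k})" by blast
  have step: "u i \<in> span (u ` {..<Suc k})" if "i \<le> k" for i
    using that by (intro span_base) auto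
  have same: "span (u ` {..<Suc k}) = span (u ` {..<k})"
    using k(2) by (simp add: lessThan_Suc span_redundant)
  have "T (u i) \<in> span (u ` {..<k})" if "i < k" for i
    using step[of "Suc i"] that unfolding same by (simp add: u_def)
  then have "T ` (u ` {..<k}) \<subseteq> span (u ` {..<k})" by auto
  then have "T ` span (u ` {..<k}) \<subseteq> span (u ` {..<k})"
    using T(1) by (simp add: linear_span_image[symmetric] span_minimal)
  moreover have "dim (T ` span (u ` {..<k})) = dim (span (u ` {..<k}))"
    using dim_image_eq[OF T(1), of "span (u ` {..<k})"] T(2) by (metis inj_on_subset subset_UNIV span_span)
  ultimately have inv: "T ` span (u ` {..<k}) = span (u ` {..<k})"
    using T(1) by (intro subspace_dim_equal) (auto intro: linear_subspace_image)
  \<comment> \<open>Passing from \<open>k\<close> to \<open>Suc k\<close> keeps the number of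
    vectors positive when \<open>z = 0\<close>.\<close>
  have "T ` span (u ` {..<Suc k}) = span (u ` {..<Suc k})"
    unfolding same by (rule inv)
  then show thesis
    using that[of "Suc k"] k(1) by (simp add: u_def)
qed

lemma funpow_contraction_bound:
  fixes A :: "'v::real_normed_vector \<Rightarrow> 'v"
  assumes "\<And>x. norm x \<le> \<kappa> * norm (A x)" "0 \<le> \<kappa>"
  shows "norm x \<le> \<kappa> ^ n * norm ((A ^^ n) x)"
proof (induction n)
  case (Suc n)
  have "norm ((A ^^ n) x) \<le> \<kappa> * norm ((A ^^ Suc n) x)"
    using assms(1)[of "(A ^^ n) x"] by simp
  then have "\<kappa> ^ n * norm ((A ^^ n) x) \<le> \<kappa> ^ n * (\<kappa> * norm ((A ^^ Suc n) x))"
    using assms(2) by (intro mult_left_mono) auto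
  then show ?case using Suc by (simp add: mult_ac)
qed simp

lemma linear_funpow:
  fixes A :: "'v::real_vector \<Rightarrow> 'v"
  shows "linear A \<Longrightarrow> linear (A ^^ n)"
  by (induction n) (auto intro!: linearI simp: linear_add linear_cmul)

text \<open>An expansion allows bounded pairings along arbitrarily late long progressions of times only if
  they vanish: these pairings control the functional on an invariant subspace, where it
  expands exponentially.\<close>

lemma bounded_progression_vanishes:
  fixes A :: "'v::euclidean_space \<Rightarrow> 'v"
  assumes A: "linear A" and exp: "\<And>x. norm x \<le> \<kappa> * norm (A x)" "0 \<le> \<kappa>" "\<kappa> < 1"
    and m: "0 < m"
    and bd: "\<And>N. \<exists>q\<ge>N. \<forall>i\<le>DIM('v). \<bar>(A ^^ (n + (q + i) * m)) z \<bullet> v\<bar> \<le> C"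
  shows "(A ^^ n) z \<bullet> v = 0"
proof (rule ccontr)
  assume neq: "(A ^^ n) z \<bullet> v \<noteq> 0"
  define T where "T = A ^^ m"
  have linT: "linear T" unfolding T_def by (rule linear_funpow[OF A])
  have expT: "norm x \<le> \<kappa> ^ m * norm (T x)" for x
    unfolding T_def by (rule funpow_contraction_bound[OF exp(1,2)])
  have "inj T"
    using expT linT by (subst linear_injective_0) (auto, metis mult_zero_right norm_le_zero_iff norm_zero)
  then obtain k where k: "0 < k" "k \<le> Suc DIM('v)"
    and inv: "T ` span ((\<lambda>i. (T ^^ i) z) ` {..<k}) = span ((\<lambda>i. (T ^^ i) z) ` {..<k})"
    using orbit_span_invariant[OF linT, of z] by blast
  define S where "S = (\<lambda>i. (T ^^ i) z) ` {..<k}"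
  have zS: "z \<in> span S" unfolding S_def using k by (intro span_base image_eqI[of _ _ 0]) auto
  obtain K where K: "\<And>\<phi> :: 'v \<Rightarrow> real. \<And>C b. linear \<phi> \<Longrightarrow> (\<forall>u\<in>S. \<bar>\<phi> u\<bar> \<le> C) \<Longrightarrow> b \<in> span S \<Longrightarrow>
     \<bar>\<phi> b\<bar> \<le> C * K * norm b"
    using bounded_on_span[of S] unfolding S_def by blast
  \<comment> \<open>\<open>T\<close> maps \<open>span S\<close> onto itself, so \<open>z\<close> has
    a backward orbit in \<open>span S\<close>; by the expansion it decays exponentially.\<close>
  have preimage: "\<exists>b\<in>span S. (T ^^ q) b = z" for q
  proof (induction q)
    case 0
    show ?case using zS by auto
  next
    case (Suc q)
    then obtain b where b: "b \<in> span S" "(T ^^ q) b = z" by blast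
    then have "b \<in> T ` span S" using inv by (simp add: S_def)
    then obtain b' where "b' \<in> span S" "T b' = b" by blast
    then show ?case using b(2) by (intro bexI[of _ b']) (simp_all add: funpow_swap1)
  qed
  have bound: "\<exists>q\<ge>N. \<bar>(A ^^ n) z \<bullet> v\<bar> \<le> \<bar>C * K\<bar> * ((\<kappa> ^ m) ^ q * norm z)" for N
  proof -
    obtain q where q: "q \<ge> N" "\<forall>i\<le>DIM('v). \<bar>(A ^^ (n + (q + i) * m)) z \<bullet> v\<bar> \<le> C"
      using bd[of N] by blast
    obtain b where b: "b \<in> span S" "(T ^^ q) b = z" using preimage[of q] by blast
    \<comment> \<open>This functional is bounded by \<open>C\<close> on \<open>S\<close>, whose
      vectors are the first points of the orbit of \<open>z\<close> under \<open>T\<close>, while at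
      \<open>b\<close> it takes the fixed value \<open>(A ^^ n) z \<bullet> v\<close>.\<close>
    have lin: "linear (\<lambda>x. (A ^^ (n + q * m)) x \<bullet> v)"
      using linear_funpow[OF A] by (auto intro!: linearI simp: linear_add linear_cmul inner_add_left)
    have TA: "(T ^^ i) x = (A ^^ (i * m)) x" for i x
      by (simp add: T_def funpow_mult mult.commute)
    have "\<forall>u\<in>S. \<bar>(A ^^ (n + q * m)) u \<bullet> v\<bar> \<le> C"
    proof
      fix u assume "u \<in> S"
      then obtain i where i: "i < k" "u = (T ^^ i) z" by (auto simp: S_def)
      then have "(A ^^ (n + q * m)) u = (A ^^ (n + (q + i) * m)) z"
        by (simp add: TA add_mult_distrib funpow_add add.assoc)
      then show "\<bar>(A ^^ (n + q * m)) u \<bullet> v\<bar> \<le> C" using q(2) i(1) k(2) by simp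
    qed
    from K[OF lin this b(1)] have "\<bar>(A ^^ (n + q * m)) b \<bullet> v\<bar> \<le> C * K * norm b" .
    also have "(A ^^ (n + q * m)) b = (A ^^ n) z"
      using b(2) by (simp add: TA funpow_add)
    also have "C * K * norm b \<le> \<bar>C * K\<bar> * norm b" by (intro mult_right_mono) auto
    also have "norm b \<le> (\<kappa> ^ m) ^ q * norm z"
      using funpow_contraction_bound[OF expT, of b q] exp(2) b(2) by simp
    finally show ?thesis using q(1) by (auto simp: mult_left_mono)
  qed
  have "\<kappa> ^ m < 1" using exp(2,3) m by (simp add: power_less_one_iff)
  then have "(\<lambda>q. \<bar>C * K\<bar> * ((\<kappa> ^ m) ^ q * norm z)) \<longlonglongrightarrow> \<bar>C * K\<bar> * (0 * norm z)"
    using exp(2) by (intro tendsto_intros LIMSEQ_power_zero) auto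
  then have "\<forall>\<^sub>F q in sequentially. \<bar>C * K\<bar> * ((\<kappa> ^ m) ^ q * norm z) < \<bar>(A ^^ n) z \<bullet> v\<bar>"
    using neq by (intro order_tendstoD) auto
  then obtain N where "\<And>q. q \<ge> N \<Longrightarrow> \<bar>C * K\<bar> * ((\<kappa> ^ m) ^ q * norm z) < \<bar>(A ^^ n) z \<bullet> v\<bar>"
    by (auto simp: eventually_sequentially)
  then show False using bound[of N] by fastforce
qed

text \<open>Beyond every \<open>N\<close> there is a progression of times of difference at most
  \<open>W\<close> along which \<open>g\<close> is constant. Infinitely many of these share the
  value of \<open>g\<close>, the difference and the residue of the starting time, hence lie on one
  infinite progression of times, as \<open>bounded_progression_vanishes\<close> demands.\<close>

theorem bounded_pairings_vanish:
  fixes A :: "'v::euclidean_space \<Rightarrow> 'v" and g :: "nat \<Rightarrow> 'v"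
  assumes A: "linear A" and exp: "\<And>x. norm x \<le> \<kappa> * norm (A x)" "0 \<le> \<kappa>" "\<kappa> < 1"
    and fin: "finite (range g)" and bd: "\<And>n. \<bar>(A ^^ n) (g n) \<bullet> v\<bar> \<le> C"
  shows "\<exists>n. (A ^^ n) (g n) \<bullet> v = 0"
proof -
  obtain h :: "'v \<Rightarrow> nat" where h: "inj_on h (range g)"
    using finite_imp_inj_to_nat_seg[OF fin] by blast
  from van_der_Waerden[of "card (range g)" "Suc DIM('v)"] obtain W where W: "\<forall>c::nat \<Rightarrow> nat.
    finite (range c) \<and> card (range c) \<le> card (range g) \<longrightarrow>
     (\<exists>a d. 0 < d \<and> d \<le> W \<and> a + Suc DIM('v) * d \<le> W \<and> (\<forall>i<Suc DIM('v). c (a + i * d) = c a))" ..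
  have prog: "\<exists>n d. N \<le> n \<and> 0 < d \<and> d \<le> W \<and> (\<forall>i\<le>DIM('v). g (n + i * d) = g n)" for N
  proof -
    let ?c = "\<lambda>n. h (g (N + n))"
    have sub: "range ?c \<subseteq> h ` range g" by auto
    then have "finite (range ?c) \<and> card (range ?c) \<le> card (range g)"
      using fin by (meson card_image_le card_mono finite_imageI finite_subset le_trans)
    from W[rule_format, OF this] obtain a d where
      ad: "0 < d" "d \<le> W" "\<forall>i<Suc DIM('v). ?c (a + i * d) = ?c a" by blast
    have "g (N + a + i * d) = g (N + a)" if "i \<le> DIM('v)" for i
    proof -
      have "h (g (N + (a + i * d))) = h (g (N + a))"
        using ad(3) that by (simp only: less_Suc_eq_le)
      then have "g (N + (a + i * d)) = g (N + a)"
        by (rule inj_onD[OF h]) auto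
      then show ?thesis by (simp only: add.assoc)
    qed
    then show ?thesis using ad by (intro exI[of _ "N + a"] exI[of _ d]) auto
  qed
  define P where "P N p \<longleftrightarrow> N \<le> fst p \<and> 0 < snd p \<and> snd p \<le> W \<and>
      (\<forall>i\<le>DIM('v). g (fst p + i * snd p) = g (fst p))" for N p
  have "\<exists>p. P N p" for N
    using prog[of N] by (auto simp: P_def)
  then have "\<forall>N. \<exists>p. P N p" by blast
  from choice[OF this] obtain p where p: "\<forall>N. P N (p N)" ..
  define n where "n N = fst (p N)" for N
  define d where "d N = snd (p N)" for N
  have nd: "N \<le> n N" "0 < d N" "d N \<le> W" "\<And>i. i \<le> DIM('v) \<Longrightarrow> g (n N + i * d N) = g (n N)" for N
    using p unfolding P_def n_def d_def by blast+
  define state where "state N = (g (n N), d N, n N mod d N)" for N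
  have "n N mod d N \<le> W" for N
    using nd(2,3)[of N] by (meson le_trans less_imp_le mod_less_divisor)
  then have "range state \<subseteq> range g \<times> {..W} \<times> {..W}"
    using nd by (auto simp: state_def)
  then have "finite (range state)"
    using fin by (meson finite_SigmaI finite_atMost finite_subset)
  then obtain N0 where N0: "infinite {N. state N = state N0}"
    using pigeonhole_infinite[of UNIV state] by auto
  define z where "z = g (n N0)"
  define m where "m = d N0"
  have m: "0 < m" using nd by (simp add: m_def)
  have "(A ^^ (n N0)) z \<bullet> v = 0"
  proof (rule bounded_progression_vanishes[OF A exp m])
    fix M
    obtain N where N: "N \<ge> n N0 + M * m" "state N = state N0"
      using N0 by (metis (mono_tags) infinite_nat_iff_unbounded_le mem_Collect_eq)
    have eq: "g (n N) = z" "d N = m" "n N mod m = n N0 mod m"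
      using N(2) by (auto simp: state_def z_def m_def)
    have "n N \<ge> n N0 + M * m" using N(1) nd(1)[of N] by linarith
    moreover obtain q where q: "n N = n N0 + q * m"
    proof -
      have "n N0 \<le> n N" using \<open>n N \<ge> n N0 + M * m\<close> by linarith
      then show thesis using mod_eq_nat1E[OF eq(3)] that by (metis mult.commute)
    qed
    ultimately have "q \<ge> M" using m by simp
    have "\<bar>(A ^^ (n N0 + (q + i) * m)) z \<bullet> v\<bar> \<le> C" if "i \<le> DIM('v)" for i
    proof -
      have "n N0 + (q + i) * m = n N + i * d N" using q eq by (simp add: algebra_simps)
      moreover have "g (n N + i * d N) = z" using nd(4)[OF that] eq by (metis state_def N(2) prod.inject z_def)
      ultimately show ?thesis using bd by metis
    qed
    then show "\<exists>q\<ge>M. \<forall>i\<le>DIM('v). \<bar>(A ^^ (n N0 + (q + i) * m)) z \<bullet> v\<bar> \<le> C"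
      using \<open>q \<ge> M\<close> by blast
  qed
  then show ?thesis unfolding z_def by blast
qed

section \<open>The integer lattice and configurations\<close>

lemma real_vec_add: "real_vec (k + m) = real_vec k + real_vec m"
  by (simp add: real_vec_def vec_eq_iff)

lemma real_vec_diff: "real_vec (k - m) = real_vec k - real_vec m"
  by (simp add: real_vec_def vec_eq_iff)

lemma real_vec_0 [simp]: "real_vec 0 = 0"
  by (simp add: real_vec_def vec_eq_iff)

lemma finite_norm_real_vec_le: "finite {k :: int^'d::finite. norm (real_vec k) \<le> r}"
proof (rule finite_subset)
  let ?B = "{-\<lfloor>r\<rfloor>..\<lfloor>r\<rfloor>}"
  show "{k :: int^'d. norm (real_vec k) \<le> r} \<subseteq> vec_lambda ` (UNIV \<rightarrow>\<^sub>E ?B)"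
  proof
    fix k :: "int^'d"
    assume "k \<in> {k. norm (real_vec k) \<le> r}"
    then have "\<bar>real_of_int (k $ i)\<bar> \<le> r" for i
      using component_le_norm_cart[of "real_vec k" i] by (simp add: real_vec_def)
    then have "real_of_int \<bar>k $ i\<bar> \<le> r" for i by simp
    then have "\<bar>k $ i\<bar> \<le> \<lfloor>r\<rfloor>" for i by (simp only: le_floor_iff)
    then have "vec_nth k \<in> UNIV \<rightarrow>\<^sub>E ?B"
      by (auto simp: abs_le_iff minus_le_iff)
    then show "k \<in> vec_lambda ` (UNIV \<rightarrow>\<^sub>E ?B)"
      by (metis image_eqI vec_nth_inverse)
  qed
  show "finite (vec_lambda ` ((UNIV :: 'd set) \<rightarrow>\<^sub>E ?B))"
    by (intro finite_imageI finite_PiE) auto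
qed

text \<open>Compactness of the product topology by a diagonal argument: in a finite alphabet some
  value of each coordinate recurs infinitely often along any given sequence.\<close>

lemma convergent_subsequence_of_configs:
  fixes s :: "nat \<Rightarrow> 'k::countable \<Rightarrow> 'c::finite"
  obtains r t where "strict_mono r"
    "\<And>P. finite P \<Longrightarrow> \<forall>\<^sub>F j in sequentially. \<forall>k\<in>P. s (r j) k = t k"
proof -
  define Const where
    "Const n \<sigma> \<longleftrightarrow> (\<exists>c. \<forall>\<^sub>F j in sequentially. s (\<sigma> j) (from_nat n) = c)" for n \<sigma>
  interpret subseqs Const
  proof
    fix n and \<sigma> :: "nat \<Rightarrow> nat"
    let ?f = "\<lambda>j. s (\<sigma> j) (from_nat n)"
    obtain j0 where "infinite {j. ?f j = ?f j0}"
      using pigeonhole_infinite[of UNIV ?f] by auto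
    then have "strict_mono (enumerate {j. ?f j = ?f j0})"
      "\<And>i. ?f (enumerate {j. ?f j = ?f j0} i) = ?f j0"
      using strict_mono_enumerate enumerate_in_set by fastforce+
    then show "\<exists>r'. strict_mono r' \<and> Const n (\<sigma> \<circ> r')"
      unfolding Const_def o_def by (metis (mono_tags, lifting) eventually_sequentiallyI)
  qed
  have const: "Const n (diagseq \<circ> (+) (Suc n))" for n
  proof (rule diagseq_holds)
    fix r \<sigma> :: "nat \<Rightarrow> nat" and n
    assume r: "strict_mono r" and "Const n \<sigma>"
    then obtain c where "\<forall>\<^sub>F j in sequentially. s (\<sigma> j) (from_nat n) = c"
      unfolding Const_def by blast
    from eventually_subseq[OF r this] show "Const n (\<sigma> \<circ> r)"
      unfolding Const_def by auto
  qed
  have ev: "\<exists>c. \<forall>\<^sub>F j in sequentially. s (diagseq (j + Suc n)) (from_nat n) = c" for n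
    using const[of n] by (simp add: Const_def add.commute)
  have "\<exists>c. \<forall>\<^sub>F j in sequentially. s (diagseq j) k = c" for k
  proof -
    obtain c where "\<forall>\<^sub>F j in sequentially. s (diagseq (j + Suc (to_nat k))) k = c"
      using ev[of "to_nat k"] by auto
    then show ?thesis
      using eventually_sequentially_seg[of "\<lambda>j. s (diagseq j) k = c"] by blast
  qed
  then have "\<forall>k. \<exists>c. \<forall>\<^sub>F j in sequentially. s (diagseq j) k = c" by blast
  from choice[OF this] obtain t where "\<forall>k. \<forall>\<^sub>F j in sequentially. s (diagseq j) k = t k" ..
  then have "\<forall>\<^sub>F j in sequentially. \<forall>k\<in>P. s (diagseq j) k = t k" if "finite P" for P
    using that by (simp add: eventually_ball_finite_distrib)
  then show thesis
    using that subseq_diagseq by blast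
qed

lemma eventually_subseq_of_subset:
  fixes P :: "'k::countable set"
  assumes "strict_mono r" "finite P"
  shows "\<forall>\<^sub>F j in sequentially. P \<subseteq> from_nat ` {..r j}"
proof (rule eventually_sequentiallyI)
  fix j assume j: "j \<ge> Max (insert 0 (to_nat ` P))"
  show "P \<subseteq> from_nat ` {..r j}"
  proof
    fix k assume "k \<in> P"
    then have "to_nat k \<le> j" using j assms(2) by simp
    also have "j \<le> r j" using assms(1) by (simp add: seq_suble)
    finally show "k \<in> from_nat ` {..r j}"
      by (intro image_eqI[of _ _ "to_nat k"]) auto
  qed
qed

definition shift :: "int^'d::finite \<Rightarrow> ('a, 'd) config \<Rightarrow> ('a, 'd) config" where
  "shift n x = (\<lambda>k. x (n + k))"

lemma shift_shift: "shift m (shift n x) = shift (n + m) x"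
  by (simp add: shift_def add.assoc)

lemma shift_0 [simp]: "shift 0 x = x"
  by (simp add: shift_def)

lemma shift_apply: "shift n x k = x (n + k)"
  by (simp add: shift_def)

lemma shift_eq_iff: "shift n x = shift m y \<longleftrightarrow> x = shift (m - n) y"
proof
  assume h: "shift n x = shift m y"
  have "x k = shift (m - n) y k" for k
    using fun_cong[OF h, of "k - n"] by (simp add: shift_apply algebra_simps)
  then show "x = shift (m - n) y" by blast
qed (simp add: shift_shift)

lemma shift_period_0:
  assumes "aperiodic X" "x \<in> X" "shift p x = x"
  shows "p = 0"
proof -
  have "is_period x p"
    using fun_cong[OF assms(3)] by (simp add: is_period_def shift_apply add.commute)
  then show ?thesis using assms(1,2) unfolding aperiodic_def by blast
qed

section \<open>The substitution on configurations\<close>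

locale constant_shape =
  fixes L :: "int^'d^'d" and F1 :: "(int^'d::finite) set"
    and \<zeta> :: "'a::finite \<Rightarrow> ('a, 'd) pattern"
  assumes css: "constant_shape_substitution L F1 \<zeta>"
begin

abbreviation "Q \<equiv> quotient L F1"
abbreviation "R \<equiv> remainder L F1"
abbreviation "X \<equiv> subst_subshift L F1 \<zeta>"

definition subst :: "('a, 'd) config \<Rightarrow> ('a, 'd) config" where
  "subst x = (\<lambda>k. the (\<zeta> (x (Q k)) (R k)))"

lemma subst_apply: "subst x k = the (\<zeta> (x (Q k)) (R k))"
  by (simp add: subst_def)

lemma subst_Suc_apply: "(subst ^^ Suc n) x k = the (\<zeta> ((subst ^^ n) x (Q k)) (R k))"
  unfolding funpow.simps comp_apply by (rule subst_apply)

lemma zero_in_F1: "0 \<in> F1"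
  using css unfolding constant_shape_substitution_def by blast

lemma Q_mult_add [simp]: "f \<in> F1 \<Longrightarrow> Q (L *v g + f) = g"
  using quotient_eq[OF css] .

lemma R_mult_add [simp]: "f \<in> F1 \<Longrightarrow> R (L *v g + f) = f"
  using remainder_eq[OF css] .

lemma R_in_F1: "R k \<in> F1"
  using decomposition[OF css, of k] by (metis R_mult_add)

lemma Q_R: "L *v Q k + R k = k"
  using decomposition[OF css, of k] by (metis R_mult_add Q_mult_add)

lemma mult_add_decompose: "L *v g + m = L *v (g + Q m) + R m"
  using Q_R[of m] by (simp add: matrix_vector_right_distrib add.assoc)

lemma Q_shift: "Q (L *v g + m) = g + Q m"
  unfolding mult_add_decompose[of g m] by (rule Q_mult_add[OF R_in_F1])

lemma R_shift: "R (L *v g + m) = R m"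
  unfolding mult_add_decompose[of g m] by (rule R_mult_add[OF R_in_F1])

lemma the_zeta: "f \<in> F1 \<Longrightarrow> \<zeta> a f = Some (the (\<zeta> a f))"
  using css unfolding constant_shape_substitution_def by (metis domIff option.collapse)

lemma subst_mult_add: "f \<in> F1 \<Longrightarrow> subst x (L *v g + f) = the (\<zeta> (x g) f)"
  by (simp add: subst_def)

lemma subst_shift: "subst (shift g x) = shift (L *v g) (subst x)"
  by (simp add: subst_apply fun_eq_iff Q_shift R_shift shift_apply)

lemma iterate_subst:
  "iterate L F1 \<zeta> n a h = Some b \<Longrightarrow> x g = a \<Longrightarrow> (subst ^^ n) x (((*v) L ^^ n) g + h) = b"
proof (induction n arbitrary: h b)
  case 0
  then show ?case by (auto split: if_splits)
next
  case (Suc n)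
  then obtain c where c: "iterate L F1 \<zeta> n a (Q h) = Some c" "\<zeta> c (R h) = Some b"
    by (auto split: option.splits)
  then have "(subst ^^ n) x (((*v) L ^^ n) g + Q h) = c" using Suc by blast
  then show ?case using c(2) unfolding subst_Suc_apply by (simp add: Q_shift R_shift)
qed

lemma subst_funpow_shift: "(subst ^^ n) (shift g x) = shift (((*v) L ^^ n) g) ((subst ^^ n) x)"
  by (induction n) (simp_all add: subst_shift)

text \<open>A pattern \<open>p\<close> occurring at \<open>m\<close> can be read on the set
  \<open>m + dom p\<close>, so restrictions of \<open>x\<close> to finite sets suffice. This form is
  suited to limits.\<close>

lemma mem_X:
  "x \<in> X \<longleftrightarrow> (\<forall>P. finite P \<longrightarrow> (\<exists>n>0. \<exists>a t. \<forall>k\<in>P. iterate L F1 \<zeta> n a (t + k) = Some (x k)))"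
proof
  assume x: "x \<in> X"
  show "\<forall>P. finite P \<longrightarrow> (\<exists>n>0. \<exists>a t. \<forall>k\<in>P. iterate L F1 \<zeta> n a (t + k) = Some (x k))"
  proof (intro allI impI)
    fix P :: "(int^'d) set" assume P: "finite P"
    let ?p = "(Some \<circ> x) |` P"
    have dom: "dom ?p = P" by auto
    have "occurs_at ?p (Some \<circ> x) 0" unfolding occurs_at_def dom by simp
    moreover have "finite (dom ?p)" using P by (simp only: dom)
    ultimately have "\<exists>n>0. \<exists>a t. occurs_at ?p (iterate L F1 \<zeta> n a) t"
      using x unfolding subst_subshift_def by blast
    then obtain n a t where "n > 0" "occurs_at ?p (iterate L F1 \<zeta> n a) t" by blast
    then have "\<forall>k\<in>P. iterate L F1 \<zeta> n a (t + k) = Some (x k)"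
      unfolding occurs_at_def dom by simp
    then show "\<exists>n>0. \<exists>a t. \<forall>k\<in>P. iterate L F1 \<zeta> n a (t + k) = Some (x k)"
      using \<open>n > 0\<close> by blast
  qed
next
  assume *: "\<forall>P. finite P \<longrightarrow> (\<exists>n>0. \<exists>a t. \<forall>k\<in>P. iterate L F1 \<zeta> n a (t + k) = Some (x k))"
  have "\<exists>n>0. \<exists>a t. occurs_at p (iterate L F1 \<zeta> n a) t"
    if p: "finite (dom p)" "occurs_at p (Some \<circ> x) m" for p m
  proof -
    obtain n a t where n: "n > 0"
      "\<forall>k\<in>(+) m ` dom p. iterate L F1 \<zeta> n a (t + k) = Some (x k)"
      using *[rule_format, OF finite_imageI[OF p(1), of "(+) m"]] by blast
    have "occurs_at p (iterate L F1 \<zeta> n a) (t + m)"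
      using n(2) p(2) unfolding occurs_at_def by (simp add: add.assoc)
    then show ?thesis using n(1) by blast
  qed
  then show "x \<in> X" unfolding subst_subshift_def by blast
qed

lemma shift_in_X:
  assumes "x \<in> X"
  shows "shift n x \<in> X"
  unfolding mem_X
proof (intro allI impI)
  fix P :: "(int^'d) set" assume P: "finite P"
  obtain m a t where "m > 0"
    "\<forall>k\<in>(+) n ` P. iterate L F1 \<zeta> m a (t + k) = Some (x k)"
    using assms[unfolded mem_X, rule_format, OF finite_imageI[OF P, of "(+) n"]] by blast
  then have "\<forall>k\<in>P. iterate L F1 \<zeta> m a ((t + n) + k) = Some (shift n x k)"
    by (simp add: add.assoc shift_apply)
  then show "\<exists>m>0. \<exists>a t. \<forall>k\<in>P. iterate L F1 \<zeta> m a (t + k) = Some (shift n x k)"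
    using \<open>m > 0\<close> by blast
qed

lemma subst_in_X:
  assumes "x \<in> X"
  shows "subst x \<in> X"
  unfolding mem_X
proof (intro allI impI)
  fix P :: "(int^'d) set" assume P: "finite P"
  obtain n a t where n: "n > 0"
    "\<forall>k\<in>Q ` P. iterate L F1 \<zeta> n a (t + k) = Some (x k)"
    using assms[unfolded mem_X, rule_format, OF finite_imageI[OF P, of Q]] by blast
  have "\<forall>k\<in>P. iterate L F1 \<zeta> (Suc n) a (L *v t + k) = Some (subst x k)"
    using n(2) the_zeta[OF R_in_F1] by (simp add: Q_shift R_shift subst_apply)
  then show "\<exists>n>0. \<exists>a t. \<forall>k\<in>P. iterate L F1 \<zeta> n a (t + k) = Some (subst x k)"
    by blast
qed

lemma subst_funpow_in_X: "x \<in> X \<Longrightarrow> (subst ^^ n) x \<in> X"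
  by (induction n) (simp_all add: subst_in_X)

lemma limit_in_X:
  assumes "\<And>P. finite P \<Longrightarrow> \<exists>y\<in>X. \<forall>k\<in>P. y k = x k"
  shows "x \<in> X"
  unfolding mem_X
proof (intro allI impI)
  fix P :: "(int^'d) set" assume P: "finite P"
  then obtain y where "y \<in> X" "\<forall>k\<in>P. y k = x k" using assms by blast
  then show "\<exists>n>0. \<exists>a t. \<forall>k\<in>P. iterate L F1 \<zeta> n a (t + k) = Some (x k)"
    using P unfolding mem_X by fastforce
qed

lemma limit_in_X_sequentially:
  assumes "\<And>j. s j \<in> X" "\<And>P. finite P \<Longrightarrow> \<forall>\<^sub>F j in sequentially. \<forall>k\<in>P. s j k = x k"
  shows "x \<in> X"
proof (rule limit_in_X)
  fix P :: "(int^'d) set" assume "finite P"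
  then have "\<forall>\<^sub>F j in sequentially. \<forall>k\<in>P. s j k = x k" by (rule assms(2))
  then obtain j where "\<forall>k\<in>P. s j k = x k" by (auto simp: eventually_sequentially)
  then show "\<exists>y\<in>X. \<forall>k\<in>P. y k = x k" using assms(1) by blast
qed

lemma invertible_L: "invertible (real_matrix L)"
  using css unfolding constant_shape_substitution_def expansion_matrix_def by blast

lemma inj_L: "inj ((*v) L)"
  using css inj_expansion_matrix unfolding constant_shape_substitution_def by blast

definition contraction :: real where
  "contraction = onorm ((*v) (matrix_inv (real_matrix L)))"

lemma contraction: "0 \<le> contraction" "contraction < 1"
  "norm x \<le> contraction * norm (real_matrix L *v x)"
proof -
  show "0 \<le> contraction" "contraction < 1"
    using css onorm_pos_le[OF matrix_vector_mul_bounded_linear]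
    unfolding contraction_def constant_shape_substitution_def expansion_matrix_def by auto
  have "matrix_inv (real_matrix L) ** real_matrix L = mat 1"
    using invertible_L someI_ex[of "\<lambda>B. real_matrix L ** B = mat 1 \<and> B ** real_matrix L = mat 1"]
    unfolding invertible_def matrix_inv_def by blast
  then have "x = matrix_inv (real_matrix L) *v (real_matrix L *v x)"
    by (simp add: matrix_vector_mul_assoc)
  then show "norm x \<le> contraction * norm (real_matrix L *v x)"
    unfolding contraction_def by (metis onorm matrix_vector_mul_bounded_linear)
qed

text \<open>Rounding down the coordinates of the preimage of \<open>f\<close> under \<open>L\<close>
  reduces \<open>f\<close> modulo the image of \<open>L\<close> to a bounded lattice point. Distinct
  representatives have distinct reductions, and bounded sets of lattice points are finite.\<close>

lemma finite_F1: "finite F1"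
proof -
  let ?A = "real_matrix L"
  obtain B where B: "?A ** B = mat 1" using invertible_L unfolding invertible_def by blast
  define u where "u f = (\<chi> i. \<lfloor>(B *v real_vec f) $ i\<rfloor>)" for f :: "int^'d"
  obtain C where C: "\<And>x. norm (?A *v x) \<le> norm x * C" "C > 0"
    using bounded_linear.pos_bounded[OF matrix_vector_mul_bounded_linear[of ?A]] by blast
  have bd: "norm (real_vec (f - L *v u f)) \<le> real CARD('d) * C" for f
  proof -
    let ?e = "B *v real_vec f - real_vec (u f)"
    have "real_vec (f - L *v u f) = ?A *v ?e"
      using B by (simp add: real_vec_diff real_matrix_mult_real_vec[symmetric]
          matrix_vector_mult_diff_distrib matrix_vector_mul_assoc)
    moreover have "norm ?e \<le> (\<Sum>i\<in>UNIV. \<bar>?e $ i\<bar>)" by (rule norm_le_l1_cart)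
    moreover have "\<bar>?e $ i\<bar> \<le> 1" for i
    proof -
      have "?e $ i = frac ((B *v real_vec f) $ i)"
        by (simp add: u_def real_vec_def frac_def)
      then show ?thesis using frac_ge_0 frac_lt_1 by (metis abs_of_nonneg less_imp_le)
    qed
    then have "(\<Sum>i\<in>UNIV. \<bar>?e $ i\<bar>) \<le> real CARD('d)"
      using sum_bounded_above[of UNIV "\<lambda>i. \<bar>?e $ i\<bar>" 1] by simp
    ultimately show ?thesis
      using C(1)[of ?e] C(2) by (smt (verit, best) mult_right_mono)
  qed
  have "inj_on (\<lambda>f. f - L *v u f) F1"
  proof (rule inj_onI)
    fix f g assume fg: "f \<in> F1" "g \<in> F1" "f - L *v u f = g - L *v u g"
    then have "L *v 0 + f = L *v (u f - u g) + g"
      by (simp add: matrix_vector_mult_diff_distrib algebra_simps)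
    then show "f = g" using fg R_mult_add by metis
  qed
  moreover have "(\<lambda>f. f - L *v u f) ` F1 \<subseteq> {k. norm (real_vec k) \<le> real CARD('d) * C}"
    using bd by blast
  then have "finite ((\<lambda>f. f - L *v u f) ` F1)"
    using finite_norm_real_vec_le by (rule finite_subset)
  ultimately show ?thesis by (rule finite_imageD[rotated])
qed

end

section \<open>Desubstitution and recurrence of patterns\<close>

lemma infinite_UNIV_int_vec: "infinite (UNIV :: (int^'d::finite) set)"
proof
  assume "finite (UNIV :: (int^'d) set)"
  moreover have "inj (\<lambda>n::int. (\<chi> i. n) :: int^'d)"
    by (rule injI) (simp add: vec_eq_iff)
  ultimately have "finite (UNIV :: int set)"
    by (meson finite_imageD finite_subset subset_UNIV)
  then show False by simp
qed

context constant_shape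
begin

text \<open>A pattern of \<open>x\<close> lies in some iterate of a letter; removing the last
  application of the substitution leaves a preimage pattern, and the remainder of its position is
  the offset \<open>f\<close>.\<close>

lemma desubstitute_locally:
  assumes x: "x \<in> X" and P: "finite P"
  shows "\<exists>f\<in>F1. \<exists>n>0. \<exists>a u y. \<forall>k\<in>P.
    iterate L F1 \<zeta> n a (u + Q (f + k)) = Some (y (Q (f + k))) \<and> x k = subst y (f + k)"
proof -
  \<comment> \<open>More than \<open>card F1\<close> positions do not fit into the image of a single
    letter. This excludes level 1, so a positive level is left after one substitution has been
    removed.\<close>
  obtain P' where P': "P \<subseteq> P'" "finite P'" "card P' > card F1"
  proof -
    obtain S :: "(int^'d) set" where S: "finite S" "card S = Suc (card F1)"
      using infinite_arbitrarily_large[OF infinite_UNIV_int_vec] by blast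
    have "card S \<le> card (P \<union> S)" using P S by (intro card_mono) auto
    then show thesis using that[of "P \<union> S"] P S by auto
  qed
  obtain n a t where n: "n > 0" "\<forall>k\<in>P'. iterate L F1 \<zeta> n a (t + k) = Some (x k)"
    using x[unfolded mem_X, rule_format, OF P'(2)] by blast
  have "n \<noteq> 1"
  proof
    assume n1: "n = 1"
    have "(+) t ` P' \<subseteq> F1"
    proof
      fix m assume "m \<in> (+) t ` P'"
      then obtain k where k: "k \<in> P'" "m = t + k" by blast
      have "\<zeta> a m = Some (x k)"
        using bspec[OF n(2) k(1)] unfolding n1 iterate_1[OF css] k(2) .
      moreover have "dom (\<zeta> a) = F1" using css unfolding constant_shape_substitution_def by blast
      ultimately show "m \<in> F1" by (metis domI)
    qed
    then have "card ((+) t ` P') \<le> card F1" by (rule card_mono[OF finite_F1])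
    then show False using P'(3) by (simp add: card_image)
  qed
  then obtain m where m: "n = Suc m" "m > 0" using n(1) by (cases n) auto
  define y where "y g = the (iterate L F1 \<zeta> m a (Q t + g))" for g
  have "iterate L F1 \<zeta> m a (Q t + Q (R t + k)) = Some (y (Q (R t + k))) \<and> x k = subst y (R t + k)"
    if "k \<in> P" for k
  proof -
    have "t + k = L *v Q t + (R t + k)" by (simp add: Q_R add.assoc[symmetric])
    then have "Q (t + k) = Q t + Q (R t + k)" "R (t + k) = R (R t + k)"
      by (metis Q_shift, metis R_shift)
    moreover have "iterate L F1 \<zeta> (Suc m) a (t + k) = Some (x k)"
      using n(2) m(1) that P'(1) by blast
    ultimately show ?thesis
      by (auto simp: y_def subst_apply split: option.splits)
  qed
  then show ?thesis using R_in_F1 m(2) by blast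
qed

text \<open>As \<open>F1\<close> is finite, one offset works for all finite sets at once: otherwise
  the union of one bad set per offset would have no offset. For this offset the local preimages have
  a limit in \<open>X\<close>.\<close>

lemma desubstitute:
  assumes x: "x \<in> X"
  shows "\<exists>f\<in>F1. \<exists>y\<in>X. x = shift f (subst y)"
proof -
  define good where "good f P \<longleftrightarrow> (\<exists>n>0. \<exists>a u y. \<forall>k\<in>P.
    iterate L F1 \<zeta> n a (u + Q (f + k)) = Some (y (Q (f + k))) \<and> x k = subst y (f + k))" for f P
  have mono: "good f P" if "good f P'" "P \<subseteq> P'" for f P P'
    using that unfolding good_def by (meson subsetD)
  have "\<exists>f\<in>F1. \<forall>P. finite P \<longrightarrow> good f P"
  proof (rule ccontr)
    assume "\<not> ?thesis"
    then have "\<forall>f\<in>F1. \<exists>P. finite P \<and> \<not> good f P" by blast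
    from bchoice[OF this] obtain P where P: "\<forall>f\<in>F1. finite (P f) \<and> \<not> good f (P f)" ..
    then have "finite (\<Union>f\<in>F1. P f)" using finite_F1 by blast
    from desubstitute_locally[OF x this] obtain f where "f \<in> F1" "good f (\<Union>f\<in>F1. P f)"
      unfolding good_def by blast
    moreover from this have "good f (P f)" using mono by blast
    ultimately show False using P by blast
  qed
  then obtain f where f: "f \<in> F1" and good: "\<And>P. finite P \<Longrightarrow> good f P" by blast
  have "\<forall>j. \<exists>y. \<exists>n>0. \<exists>a u. \<forall>k\<in>from_nat ` {..j}.
    iterate L F1 \<zeta> n a (u + Q (f + k)) = Some (y (Q (f + k))) \<and> x k = subst y (f + k)"
    using good[unfolded good_def, OF finite_imageI[OF finite_atMost]] by blast
  from choice[OF this] obtain y where y: "\<forall>j. \<exists>n>0. \<exists>a u. \<forall>k\<in>from_nat ` {..j}.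
    iterate L F1 \<zeta> n a (u + Q (f + k)) = Some (y j (Q (f + k))) \<and> x k = subst (y j) (f + k)" ..
  obtain r z where r: "strict_mono r"
    and z: "\<And>S. finite S \<Longrightarrow> \<forall>\<^sub>F j in sequentially. \<forall>g\<in>S. y (r j) g = z g"
    using convergent_subsequence_of_configs[of y] by blast
  have both: "\<exists>j. P \<subseteq> from_nat ` {..r j} \<and> (\<forall>g\<in>S. y (r j) g = z g)" if "finite P" "finite S" for P S
    using eventually_conj[OF eventually_subseq_of_subset[OF r that(1)] z[OF that(2)]]
    by (auto simp: eventually_sequentially)
  have "z \<in> X"
    unfolding mem_X
  proof (intro allI impI)
    fix S :: "(int^'d) set" assume S: "finite S"
    obtain j where j: "(\<lambda>g. L *v g - f) ` S \<subseteq> from_nat ` {..r j}" "\<forall>g\<in>S. y (r j) g = z g"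
      using both[OF finite_imageI[OF S] S] by blast
    obtain n a u where n: "n > 0" "\<forall>k\<in>from_nat ` {..r j}.
      iterate L F1 \<zeta> n a (u + Q (f + k)) = Some (y (r j) (Q (f + k))) \<and>
        x k = subst (y (r j)) (f + k)"
      using spec[OF y, of "r j"] by (elim exE conjE) (rule that)
    have "iterate L F1 \<zeta> n a (u + g) = Some (z g)" if "g \<in> S" for g
    proof -
      \<comment> \<open>Since \<open>0 \<in> F1\<close>, the letter of the preimage at
        \<open>g\<close> is seen by \<open>x\<close> at position \<open>L *v g - f\<close>.\<close>
      have eq: "Q (f + (L *v g - f)) = g" using Q_mult_add[OF zero_in_F1, of g] by simp
      have "L *v g - f \<in> from_nat ` {..r j}" using j(1) that by blast
      from bspec[OF n(2) this] have "iterate L F1 \<zeta> n a (u + g) = Some (y (r j) g)"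
        unfolding eq by (rule conjunct1)
      then show ?thesis using j(2) that by simp
    qed
    then show "\<exists>n>0. \<exists>a t. \<forall>k\<in>S. iterate L F1 \<zeta> n a (t + k) = Some (z k)"
      using n(1) by blast
  qed
  moreover have "x k = shift f (subst z) k" for k
  proof -
    obtain j where j: "{k} \<subseteq> from_nat ` {..r j}" "\<forall>g\<in>{Q (f + k)}. y (r j) g = z g"
      using both[of "{k}" "{Q (f + k)}"] by blast
    have "\<forall>k\<in>from_nat ` {..r j}. x k = subst (y (r j)) (f + k)"
      using spec[OF y, of "r j"] by blast
    then have "x k = subst (y (r j)) (f + k)" using j(1) by blast
    then show ?thesis using j(2) by (simp add: shift_apply subst_apply)
  qed
  ultimately show ?thesis using f by blast
qed

lemma desubstitute_funpow:
  assumes "x \<in> X"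
  shows "\<exists>f. \<exists>y\<in>X. x = shift f ((subst ^^ n) y)"
  using assms
proof (induction n arbitrary: x)
  case 0
  then show ?case by (intro exI[of _ 0] bexI[of _ x]) auto
next
  case (Suc n)
  obtain f y where y: "y \<in> X" "x = shift f ((subst ^^ n) y)" using Suc by blast
  obtain g z where "z \<in> X" "y = shift g (subst z)" using desubstitute[OF y(1)] by blast
  then have "z \<in> X" "x = shift (((*v) L ^^ n) g + f) ((subst ^^ Suc n) z)"
    using y(2) by (simp_all add: subst_funpow_shift shift_shift funpow_swap1)
  then show ?case by blast
qed

text \<open>This is minimality of \<open>X\<close>: the pattern lies in the \<open>n\<close>-th
  image of a letter \<open>a\<close>, by primitivity \<open>a\<close> lies in the
  \<open>N\<close>-th image of any letter, and \<open>x\<close> is a translate of an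
  \<open>(n + N)\<close>-th image.\<close>

lemma patterns_recur:
  assumes prim: "primitive L F1 \<zeta>" and x: "x \<in> X" and z: "z \<in> X" and P: "finite P"
  shows "\<exists>t. \<forall>k\<in>P. x (t + k) = z k"
proof -
  obtain N where N: "\<And>a b. b \<in> ran (iterate L F1 \<zeta> N a)" using prim unfolding primitive_def by blast
  obtain n a t where n: "\<forall>k\<in>P. iterate L F1 \<zeta> n a (t + k) = Some (z k)"
    using z[unfolded mem_X, rule_format, OF P] by blast
  obtain f y where y: "x = shift f ((subst ^^ (n + N)) y)" using desubstitute_funpow[OF x] by blast
  obtain h where h: "iterate L F1 \<zeta> N (y 0) h = Some a" using N[of a "y 0"] by (auto simp: ran_def)
  let ?g = "((*v) L ^^ N) 0 + h"
  have "(subst ^^ N) y ?g = a" by (rule iterate_subst[OF h]) (rule refl)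
  then have "(subst ^^ n) ((subst ^^ N) y) (((*v) L ^^ n) ?g + (t + k)) = z k" if "k \<in> P" for k
    by (rule iterate_subst[OF bspec[OF n that]])
  then have "\<forall>k\<in>P. x ((((*v) L ^^ n) ?g + t - f) + k) = z k"
    by (simp add: y shift_apply funpow_add add.assoc)
  then show ?thesis by blast
qed

lemma funpow_L_add: "((*v) L ^^ n) (g + h) = ((*v) L ^^ n) g + ((*v) L ^^ n) h"
  by (induction n) (simp_all add: matrix_vector_right_distrib)

text \<open>Along a fixed class modulo the \<open>n\<close>-th power of \<open>L\<close>, the image
  depends on single letters through a map \<open>\<sigma>\<close> that is the same for all points.
  Only finitely many such maps exist, which drives the pigeonhole argument for
  recognizability.\<close>

lemma subst_funpow_local: "\<exists>\<sigma> u. \<forall>x k. (subst ^^ n) x (((*v) L ^^ n) k + m) = \<sigma> (x (k + u))"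
proof (induction n arbitrary: m)
  case 0
  show ?case by (intro exI[of _ "\<lambda>a. a"] exI[of _ m]) auto
next
  case (Suc n)
  obtain \<sigma> u where "\<forall>x k. (subst ^^ n) x (((*v) L ^^ n) k + Q m) = \<sigma> (x (k + u))"
    using Suc.IH by blast
  then have "\<forall>x k. (subst ^^ Suc n) x (((*v) L ^^ Suc n) k + m) = the (\<zeta> (\<sigma> (x (k + u))) (R m))"
    unfolding subst_Suc_apply by (simp add: Q_shift R_shift)
  then show ?case by (intro exI[of _ "\<lambda>a. the (\<zeta> (\<sigma> a) (R m))"] exI[of _ u])
qed

end

text \<open>The face of the hull on which \<open>v\<close> is minimal is compact and convex, so it
  has an extreme point; this is extreme in the hull as well and hence comes from
  \<open>F\<close>.\<close>

lemma ex_minimizing_vertex: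
  fixes v :: "real^'d::finite"
  assumes "finite F" "F \<noteq> {}"
  obtains e where "e \<in> F" "real_vec e extreme_point_of (convex hull (real_vec ` F))"
    "\<And>f. f \<in> F \<Longrightarrow> v \<bullet> real_vec e \<le> v \<bullet> real_vec f"
proof -
  let ?H = "convex hull (real_vec ` F)"
  define m where "m = Min ((\<lambda>f. v \<bullet> real_vec f) ` F)"
  have m: "m \<le> v \<bullet> real_vec f" if "f \<in> F" for f
    using assms that by (simp add: m_def)
  have "?H \<subseteq> {x. v \<bullet> x \<ge> m}"
    using m by (intro hull_minimal convex_halfspace_ge) auto
  then have face: "(?H \<inter> {x. v \<bullet> x = m}) face_of ?H"
    by (intro face_of_Int_supporting_hyperplane_ge convex_convex_hull) auto
  have "m \<in> (\<lambda>f. v \<bullet> real_vec f) ` F" unfolding m_def using assms by (intro Min_in) auto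
  then obtain f where "f \<in> F" "v \<bullet> real_vec f = m" by auto
  then have "?H \<inter> {x. v \<bullet> x = m} \<noteq> {}" by (auto intro: hull_inc)
  moreover have "compact (?H \<inter> {x. v \<bullet> x = m})"
    using assms by (intro compact_Int_closed finite_imp_compact_convex_hull closed_hyperplane) auto
  ultimately obtain p where "p extreme_point_of (?H \<inter> {x. v \<bullet> x = m})"
    using extreme_point_exists_convex face_of_imp_convex[OF face] by blast
  then have p: "p extreme_point_of ?H" "v \<bullet> p = m"
    using extreme_point_of_face[OF face, of p] by auto
  then obtain e where "e \<in> F" "p = real_vec e" using extreme_point_of_convex_hull by blast
  then show thesis using that[of e] p m by simp
qed

locale permutative_constant_shape = constant_shape L F1 \<zeta>
  for L :: "int^'d^'d" and F1 :: "(int^'d::finite) set"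
    and \<zeta> :: "'a::finite \<Rightarrow> ('a, 'd) pattern" +
  assumes prim: "primitive L F1 \<zeta>"
    and aper: "aperiodic (subst_subshift L F1 \<zeta>)"
    and perm: "extremally_permutative F1 \<zeta>"
begin

lemma ex_permutative_minimizer:
  obtains e where "e \<in> F1" "bij (\<lambda>a. the (\<zeta> a e))" "\<And>f. f \<in> F1 \<Longrightarrow> v \<bullet> real_vec e \<le> v \<bullet> real_vec f"
proof -
  have "F1 \<noteq> {}" using zero_in_F1 by blast
  then obtain e where "e \<in> F1" "real_vec e extreme_point_of (convex hull (real_vec ` F1))"
    "\<And>f. f \<in> F1 \<Longrightarrow> v \<bullet> real_vec e \<le> v \<bullet> real_vec f"
    using ex_minimizing_vertex[OF finite_F1, where v = v] by blast
  then show thesis using that perm unfolding extremally_permutative_def by blast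
qed

text \<open>At a vertex of the hull of \<open>F1\<close> the substitution permutes the letters.
  Following this vertex through \<open>n\<close> levels recovers each letter of \<open>x\<close>
  from a single letter of its \<open>n\<close>-th image.\<close>

lemma subst_funpow_invert: "\<exists>\<tau> e. \<forall>x k. x k = \<tau> ((subst ^^ n) x (((*v) L ^^ n) k + e))"
proof (induction n)
  case 0
  show ?case by (intro exI[of _ "\<lambda>a. a"] exI[of _ 0]) auto
next
  case (Suc n)
  obtain e where e: "e \<in> F1" "bij (\<lambda>a. the (\<zeta> a e))"
    using ex_permutative_minimizer by blast
  obtain \<tau> e' where IH: "\<forall>x k. x k = \<tau> ((subst ^^ n) x (((*v) L ^^ n) k + e'))" using Suc by blast
  let ?\<pi> = "\<lambda>a. the (\<zeta> a e)"
  have "x k = \<tau> (inv ?\<pi> ((subst ^^ Suc n) x (((*v) L ^^ Suc n) k + (L *v e' + e))))" for x k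
  proof -
    have "((*v) L ^^ Suc n) k + (L *v e' + e) = L *v (((*v) L ^^ n) k + e') + e"
      by (simp add: matrix_vector_right_distrib add.assoc)
    then have "(subst ^^ Suc n) x (((*v) L ^^ Suc n) k + (L *v e' + e)) = ?\<pi> ((subst ^^ n) x (((*v) L ^^ n) k + e'))"
      using e(1) by (simp only: subst_Suc_apply Q_mult_add R_mult_add)
    then have "inv ?\<pi> ((subst ^^ Suc n) x (((*v) L ^^ Suc n) k + (L *v e' + e))) = (subst ^^ n) x (((*v) L ^^ n) k + e')"
      using inv_f_f[OF bij_is_inj[OF e(2)]] by simp
    then show ?thesis using IH by simp
  qed
  then have "\<forall>x k. x k = (\<lambda>b. \<tau> (inv ?\<pi> b)) ((subst ^^ Suc n) x (((*v) L ^^ Suc n) k + (L *v e' + e)))"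
    by blast
  then show ?case by (intro exI)
qed

lemma inj_subst: "inj subst"
proof (rule injI)
  fix x y assume "subst x = subst y"
  then have eq: "(subst ^^ 1) x = (subst ^^ 1) y" by simp
  obtain \<tau> e where "\<forall>x k. x k = \<tau> ((subst ^^ 1) x (((*v) L ^^ 1) k + e))"
    using subst_funpow_invert by blast
  then have "x k = \<tau> ((subst ^^ 1) x (((*v) L ^^ 1) k + e))"
    "y k = \<tau> ((subst ^^ 1) y (((*v) L ^^ 1) k + e))" for k
    by blast+
  then have "x k = y k" for k using eq by simp
  then show "x = y" by blast
qed

section \<open>Recognizability\<close>

text \<open>By minimality, translates of \<open>y\<close> converge to \<open>z\<close>; the
  corresponding translates of \<open>x\<close> have a limit point \<open>z'\<close>. The offset
  \<open>r\<close> survives because both images are translated by the same vector.\<close>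

lemma nonrecognizable_everywhere:
  assumes x: "x \<in> X" and y: "y \<in> X" and eq: "subst x = shift r (subst y)" and z: "z \<in> X"
  shows "\<exists>z'\<in>X. subst z' = shift r (subst z)"
proof -
  have "\<forall>j. \<exists>t. \<forall>k\<in>from_nat ` {..j}. y (t + k) = z k"
    using patterns_recur[OF prim y z finite_imageI[OF finite_atMost]] by blast
  from choice[OF this] obtain t where t: "\<forall>j. \<forall>k\<in>from_nat ` {..j}. y (t j + k) = z k" ..
  obtain s z' where s: "strict_mono s"
    and z': "\<And>P. finite P \<Longrightarrow> \<forall>\<^sub>F j in sequentially. \<forall>k\<in>P. shift (t (s j)) x k = z' k"
    using convergent_subsequence_of_configs[of "\<lambda>j. shift (t j) x"] by blast
  have "z' \<in> X"
    by (rule limit_in_X_sequentially[where s = "\<lambda>j. shift (t (s j)) x"]) (use z' shift_in_X[OF x] in auto)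
  moreover have "subst z' k = shift r (subst z) k" for k
  proof -
    have "finite {Q k}" "finite {Q (r + k)}" by auto
    from eventually_conj[OF z'[OF this(1)] eventually_subseq_of_subset[OF s this(2)]]
    obtain j where j: "shift (t (s j)) x (Q k) = z' (Q k)" "Q (r + k) \<in> from_nat ` {..s j}"
      by (auto simp: eventually_sequentially)
    have "y (t (s j) + Q (r + k)) = z (Q (r + k))"
      using t j(2) by blast
    then have "subst (shift (t (s j)) y) (r + k) = subst z (r + k)"
      by (simp only: subst_apply shift_apply)
    moreover have "subst (shift (t (s j)) x) k = subst (shift (t (s j)) y) (r + k)"
      unfolding subst_shift shift_apply eq by (simp add: add_ac)
    moreover have "subst (shift (t (s j)) x) k = subst z' k"
      unfolding subst_apply j(1) ..
    ultimately show ?thesis by (simp only: shift_apply)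
  qed
  ultimately show ?thesis by blast
qed

text \<open>The exceptional relation is transported to the \<open>n\<close>-th image of
  \<open>z\<close>, and the point on its other side is desubstituted \<open>n\<close> times. This
  changes the offset by an element of the image of \<open>L\<close> only.\<close>

lemma nonrecognizable_iterates:
  assumes x: "x \<in> X" and y: "y \<in> X" and eq: "subst x = shift r (subst y)"
    and r: "r \<notin> range ((*v) L)" and z: "z \<in> X"
  shows "\<exists>\<rho>. \<rho> \<notin> range ((*v) L) \<and> (\<exists>z'\<in>X. (subst ^^ Suc n) z' = shift \<rho> ((subst ^^ Suc n) z))"
proof -
  obtain w where w: "w \<in> X" "subst w = shift r (subst ((subst ^^ n) z))"
    using nonrecognizable_everywhere[OF x y eq subst_funpow_in_X[OF z]] by blast
  obtain f z' where z': "z' \<in> X" "w = shift f ((subst ^^ n) z')"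
    using desubstitute_funpow[OF w(1)] by blast
  have "shift (L *v f) ((subst ^^ Suc n) z') = shift r ((subst ^^ Suc n) z)"
    using w(2) unfolding z'(2) by (simp add: subst_shift)
  then have "(subst ^^ Suc n) z' = shift (r - L *v f) ((subst ^^ Suc n) z)"
    by (rule iffD1[OF shift_eq_iff])
  moreover have "r - L *v f \<notin> range ((*v) L)"
  proof
    assume "r - L *v f \<in> range ((*v) L)"
    then obtain g where "r = L *v (g + f)" by (auto simp: algebra_simps)
    then show False using r by blast
  qed
  ultimately show ?thesis using z'(1) by blast
qed

text \<open>Suppose that some translate by \<open>r \<notin> L \<int>\<^sup>d\<close> of a substitution image is a substitution image. By
  minimality and desubstitution, for each \<open>n\<close> every point then has \<open>n\<close> translates of its \<open>n\<close>-th
  image, inequivalent modulo \<open>L\<^sup>n \<int>\<^sup>d\<close>, that are \<open>n\<close>-th images. By permutativity their preimages arise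
  from the point by a translation and a map between letters; there are finitely many such maps, so
  two of the preimages agree up to translation, which creates a period.\<close>

theorem recognizability:
  assumes x: "x \<in> X" and y: "y \<in> X" and eq: "subst x = shift r (subst y)"
  shows "r \<in> range ((*v) L)"
proof (rule ccontr)
  assume r: "r \<notin> range ((*v) L)"
  \<comment> \<open>One more than the number of maps between letters, so that two of the
    \<open>n\<close> preimages come from the same map.\<close>
  define n where "n = Suc (card (UNIV :: ('a \<Rightarrow> 'a) set))"
  let ?S = "subst ^^ n" and ?L = "\<lambda>n. (*v) L ^^ n"
  have pre: "\<exists>\<rho> \<sigma> u z. \<rho> \<notin> range ((*v) L) \<and> ?S z = shift (?L i \<rho>) (?S x) \<and> z = (\<lambda>k. \<sigma> (x (k + u)))"
    if i: "i < n" for i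
  proof -
    \<comment> \<open>The relation at level \<open>Suc m\<close> is substituted \<open>i\<close>
      more times, which multiplies the offset \<open>\<rho>\<close> by the \<open>i\<close>-th power
      of \<open>L\<close>. Different \<open>i\<close> are thus told apart by divisibility by powers
      of \<open>L\<close>.\<close>
    obtain m where m: "n = i + Suc m" using less_imp_Suc_add[OF i] by auto
    obtain \<rho> z where \<rho>: "\<rho> \<notin> range ((*v) L)" and z: "(subst ^^ Suc m) z = shift \<rho> ((subst ^^ Suc m) x)"
      using nonrecognizable_iterates[OF x y eq r x] by blast
    have z': "?S z = shift (?L i \<rho>) (?S x)"
      unfolding m funpow_add comp_apply z subst_funpow_shift ..
    obtain \<tau> e where \<tau>: "\<forall>x k. x k = \<tau> (?S x (?L n k + e))"
      using subst_funpow_invert[of n] by blast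
    obtain \<sigma> u where \<sigma>: "\<forall>x k. ?S x (?L n k + (?L i \<rho> + e)) = \<sigma> (x (k + u))"
      using subst_funpow_local[of n "?L i \<rho> + e"] by blast
    have "z k = \<tau> (\<sigma> (x (k + u)))" for k
    proof -
      have "z k = \<tau> (?S z (?L n k + e))" using \<tau> by blast
      also have "?S z (?L n k + e) = ?S x (?L n k + (?L i \<rho> + e))"
        unfolding z' shift_apply by (simp only: add_ac)
      also have "\<dots> = \<sigma> (x (k + u))" using \<sigma> by blast
      finally show ?thesis .
    qed
    then have "z = (\<lambda>k. (\<lambda>a. \<tau> (\<sigma> a)) (x (k + u)))" by (simp add: fun_eq_iff)
    with \<rho> z' show ?thesis by (intro exI conjI)
  qed
  have "\<forall>i\<in>{..<n}. \<exists>p. fst p \<notin> range ((*v) L) \<and>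
      ?S (\<lambda>k. fst (snd p) (x (k + snd (snd p)))) = shift (?L i (fst p)) (?S x)"
  proof
    fix i assume "i \<in> {..<n}"
    then obtain \<rho> \<sigma> u z where "\<rho> \<notin> range ((*v) L)" "?S z = shift (?L i \<rho>) (?S x)" "z = (\<lambda>k. \<sigma> (x (k + u)))"
      using pre[of i] by blast
    then show "\<exists>p. fst p \<notin> range ((*v) L) \<and>
      ?S (\<lambda>k. fst (snd p) (x (k + snd (snd p)))) = shift (?L i (fst p)) (?S x)"
      by (intro exI[of _ "(\<rho>, \<sigma>, u)"]) simp
  qed
  from bchoice[OF this] obtain p where p: "\<forall>i\<in>{..<n}. fst (p i) \<notin> range ((*v) L) \<and>
      ?S (\<lambda>k. fst (snd (p i)) (x (k + snd (snd (p i))))) = shift (?L i (fst (p i))) (?S x)" ..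
  have "\<not> inj_on (\<lambda>i. fst (snd (p i))) {..<n}"
    using card_inj_on_le[of "\<lambda>i. fst (snd (p i))" "{..<n}" UNIV] by (auto simp: n_def)
  then obtain i j where ij: "i < j" "j < n" "fst (snd (p i)) = fst (snd (p j))"
    unfolding inj_on_def by (metis lessThan_iff linorder_neqE_nat)
  define \<rho> where "\<rho> i = fst (p i)" for i
  define u where "u i = snd (snd (p i))" for i
  define z where "z i = (\<lambda>k. fst (snd (p i)) (x (k + u i)))" for i
  have \<rho>: "\<rho> i \<notin> range ((*v) L)" and Sz: "?S (z i) = shift (?L i (\<rho> i)) (?S x)" if "i < n" for i
    using p that unfolding \<rho>_def u_def z_def by blast+
  have "z i = shift (u i - u j) (z j)"
    unfolding z_def ij(3) by (simp add: shift_def add_ac)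
  then have "shift (?L i (\<rho> i)) (?S x) = shift (?L n (u i - u j)) (shift (?L j (\<rho> j)) (?S x))"
    using Sz[of i] Sz[of j] ij by (simp add: subst_funpow_shift)
  then have "shift (?L j (\<rho> j) + ?L n (u i - u j) - ?L i (\<rho> i)) (?S x) = ?S x"
    unfolding shift_shift by (rule iffD1[OF shift_eq_iff, symmetric])
  then have "?L j (\<rho> j) + ?L n (u i - u j) - ?L i (\<rho> i) = 0"
    using shift_period_0[OF aper subst_funpow_in_X[OF x]] by blast
  \<comment> \<open>All terms except \<open>?L i (\<rho> i)\<close> are divisible by the power
    \<open>Suc i\<close> of \<open>L\<close>; cancelling \<open>?L i\<close> puts
    \<open>\<rho> i\<close> into the image of \<open>L\<close>.\<close>
  moreover obtain a where "j = i + Suc a" using less_imp_Suc_add[OF ij(1)] by auto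
  moreover obtain b where "n = i + Suc b"
    using less_imp_Suc_add[OF less_trans[OF ij(1,2)]] by auto
  ultimately have "?L i (\<rho> i) = ?L i (L *v (?L a (\<rho> j) + ?L b (u i - u j)))"
    by (simp add: funpow_add funpow_L_add matrix_vector_right_distrib funpow_swap1)
  moreover have "inj (?L i)" by (rule inj_fn[OF inj_L])
  ultimately have "\<rho> i = L *v (?L a (\<rho> j) + ?L b (u i - u j))" by (rule injD[rotated])
  then show False using \<rho>[of i] ij by auto
qed

lemma shift_subst_unique:
  assumes "x \<in> X" "y \<in> X" "f \<in> F1" "g \<in> F1" "shift f (subst x) = shift g (subst y)"
  shows "f = g" "x = y"
proof -
  have "subst x = shift (g - f) (subst y)" using assms(5) by (rule iffD1[OF shift_eq_iff])
  then obtain h where "g - f = L *v h" using recognizability assms by blast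
  then have "L *v 0 + g = L *v h + f" by (simp add: algebra_simps)
  then show "f = g" using assms(3,4) R_mult_add by metis
  then show "x = y" using assms(5) inj_subst by (simp add: shift_eq_iff inj_eq)
qed

section \<open>Pairs of points that agree on a half space\<close>

abbreviation A :: "real^'d \<Rightarrow> real^'d" where "A \<equiv> (*v) (real_matrix L)"

text \<open>Translating by multiples of \<open>L *v u\<close> moves every window deep into the half
  space. In the limit the two images agree everywhere, with unchanged offsets because the
  translations lie in the image of \<open>L\<close>, and recognizability applies.\<close>

lemma same_offset_on_half_space:
  assumes x: "x' \<in> X" and y: "y' \<in> X" and f: "f \<in> F1" and g: "g \<in> F1"
    and u: "A (real_vec u) \<bullet> v < 0"
    and agree: "\<And>k. real_vec k \<bullet> v < 0 \<Longrightarrow> shift f (subst x') k = shift g (subst y') k"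
  shows "f = g"
proof -
  define U :: "nat \<Rightarrow> int^'d" where "U j = (\<chi> i. int j * u $ i)" for j
  have U: "real_vec (U j) = real j *\<^sub>R real_vec u" for j
    by (simp add: U_def real_vec_def vec_eq_iff)
  define s where "s j k = (x' (U j + k), y' (U j + k))" for j k
  obtain r t where r: "strict_mono r"
    and t: "\<And>P. finite P \<Longrightarrow> \<forall>\<^sub>F j in sequentially. \<forall>k\<in>P. s (r j) k = t k"
    using convergent_subsequence_of_configs[of s] by blast
  define t1 where "t1 k = fst (t k)" for k
  define t2 where "t2 k = snd (t k)" for k
  have t1: "\<forall>\<^sub>F j in sequentially. \<forall>k\<in>P. shift (U (r j)) x' k = t1 k" if "finite P" for P
    using t[OF that] by eventually_elim (auto simp: s_def t1_def shift_apply prod_eq_iff)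
  have t2: "\<forall>\<^sub>F j in sequentially. \<forall>k\<in>P. shift (U (r j)) y' k = t2 k" if "finite P" for P
    using t[OF that] by eventually_elim (auto simp: s_def t2_def shift_apply prod_eq_iff)
  have X: "t1 \<in> X" "t2 \<in> X"
    using limit_in_X_sequentially[of "\<lambda>j. shift (U (r j)) x'" t1]
      limit_in_X_sequentially[of "\<lambda>j. shift (U (r j)) y'" t2] t1 t2 shift_in_X x y by blast+
  have "shift f (subst t1) k = shift g (subst t2) k" for k
  proof -
    have "filterlim (\<lambda>j. - (A (real_vec u) \<bullet> v) * real (r j)) at_top sequentially"
      using u filterlim_compose[OF filterlim_real_sequentially filterlim_subseq[OF r]]
      by (intro filterlim_tendsto_pos_mult_at_top[OF tendsto_const]) auto
    then have "\<forall>\<^sub>F j in sequentially. real_vec k \<bullet> v < - (A (real_vec u) \<bullet> v) * real (r j)"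
      by (rule spec[OF iffD1[OF filterlim_at_top_dense]])
    from eventually_conj[OF this eventually_conj[OF t1[of "{Q (f + k)}"] t2[of "{Q (g + k)}"]]]
    obtain j where j: "real_vec k \<bullet> v < - (A (real_vec u) \<bullet> v) * real (r j)"
      "shift (U (r j)) x' (Q (f + k)) = t1 (Q (f + k))" "shift (U (r j)) y' (Q (g + k)) = t2 (Q (g + k))"
      by (auto simp: eventually_sequentially)
    have "real_vec (L *v U (r j) + k) \<bullet> v < 0"
      using j(1) by (simp add: real_vec_add inner_add_left real_matrix_mult_real_vec[symmetric] U
          matrix_vector_mult_scaleR mult.commute)
    then have "subst x' (f + (L *v U (r j) + k)) = subst y' (g + (L *v U (r j) + k))"
      using agree by (simp only: shift_apply)
    then have "subst (shift (U (r j)) x') (f + k) = subst (shift (U (r j)) y') (g + k)"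
      by (simp add: subst_shift shift_apply add_ac)
    then show ?thesis
      using j(2,3) by (simp only: shift_apply subst_apply)
  qed
  then show ?thesis using shift_subst_unique(1)[OF X f g] by blast
qed

end

section \<open>Minimizers, the transpose of \<open>L\<close>, and agreeing pairs\<close>

definition minimizers :: "(int^'d::finite) set \<Rightarrow> real^'d \<Rightarrow> (int^'d) set" where
  "minimizers F v = {e\<in>F. \<forall>f\<in>F. v \<bullet> real_vec e \<le> v \<bullet> real_vec f}"

lemma minimizers_nonneg: "f \<in> minimizers F v \<Longrightarrow> h \<in> F \<Longrightarrow> 0 \<le> real_vec (h - f) \<bullet> v"
  unfolding minimizers_def by (auto simp: real_vec_diff inner_diff_right inner_commute[of _ v])

lemma minimizers_mem_iff:
  assumes "f \<in> minimizers F v" "h \<in> F"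
  shows "h \<in> minimizers F v \<longleftrightarrow> real_vec (h - f) \<bullet> v = 0"
proof
  assume "h \<in> minimizers F v"
  then have "v \<bullet> real_vec h \<le> v \<bullet> real_vec f" "v \<bullet> real_vec f \<le> v \<bullet> real_vec h"
    using assms unfolding minimizers_def by auto
  then show "real_vec (h - f) \<bullet> v = 0" by (simp add: real_vec_diff inner_diff_right inner_commute[of _ v])
next
  assume "real_vec (h - f) \<bullet> v = 0"
  then have "v \<bullet> real_vec h = v \<bullet> real_vec f"
    by (simp add: real_vec_diff inner_diff_right inner_commute[of _ v])
  then show "h \<in> minimizers F v" using assms unfolding minimizers_def by simp
qed

context constant_shape
begin

text \<open>Multiplication by a row vector from the left, that is, the transpose of \<open>L\<close>
  acting on directions.\<close>

definition pull :: "real^'d \<Rightarrow> real^'d" where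
  "pull v = v v* real_matrix L"

lemma inner_pull: "x \<bullet> pull v = (real_matrix L *v x) \<bullet> v"
  by (metis pull_def dot_lmul_matrix inner_commute)

lemma inner_pull_real_vec: "real_vec g \<bullet> pull v = real_vec (L *v g) \<bullet> v"
  by (simp add: inner_pull real_matrix_mult_real_vec)

lemma inner_pull_funpow: "x \<bullet> (pull ^^ n) v = ((*v) (real_matrix L) ^^ n) x \<bullet> v"
proof (induction n arbitrary: v)
  case (Suc n)
  have "x \<bullet> (pull ^^ Suc n) v = x \<bullet> (pull ^^ n) (pull v)" by (simp only: funpow_Suc_right comp_apply)
  also have "\<dots> = ((*v) (real_matrix L) ^^ Suc n) x \<bullet> v" by (simp add: Suc inner_pull)
  finally show ?case .
qed simp

lemma pull_eq_0: "pull v = 0 \<Longrightarrow> v = 0"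
proof -
  assume "pull v = 0"
  obtain B where "real_matrix L ** B = mat 1" using invertible_L unfolding invertible_def by blast
  then have "real_matrix L *v (B *v v) = v" by (simp add: matrix_vector_mul_assoc)
  then have "v \<bullet> v = (B *v v) \<bullet> pull v" by (simp add: inner_pull)
  then show "v = 0" using \<open>pull v = 0\<close> by simp
qed

lemma pull_funpow_nonzero: "v \<noteq> 0 \<Longrightarrow> (pull ^^ n) v \<noteq> 0"
  by (induction n) (use pull_eq_0 in auto)

lemma ex_lattice_negative:
  assumes "v \<noteq> 0"
  obtains u where "(real_matrix L *v real_vec u) \<bullet> v < 0"
proof -
  obtain i where i: "pull v $ i \<noteq> 0"
    using assms pull_eq_0 by (metis vec_eq_iff zero_index)
  define u :: "int^'d" where "u = axis i (if pull v $ i > 0 then -1 else 1)"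
  have "real_vec u = axis i (if pull v $ i > 0 then -1 else 1)"
    by (auto simp: u_def real_vec_def axis_def vec_eq_iff)
  then have "real_vec u \<bullet> pull v = (if pull v $ i > 0 then -1 else 1) * pull v $ i"
    by (simp add: inner_axis' )
  also have "\<dots> < 0" using i by auto
  finally show thesis using that by (simp add: inner_pull)
qed

text \<open>Placing a disagreement at the origin makes nondeterminism a condition that survives
  limits and desubstitution. The direction is not normalized, since \<open>pull\<close> does not
  preserve the norm.\<close>

definition agreeing_pair :: "real^'d \<Rightarrow> ('a, 'd) config \<Rightarrow> ('a, 'd) config \<Rightarrow> bool" where
  "agreeing_pair v x y \<longleftrightarrow> x \<in> X \<and> y \<in> X \<and> x 0 \<noteq> y 0 \<and> (\<forall>k. x k \<noteq> y k \<longrightarrow> 0 \<le> real_vec k \<bullet> v)"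

lemma mem_ND_iff: "v \<in> ND X \<longleftrightarrow> norm v = 1 \<and>
    (\<exists>x\<in>X. \<exists>y\<in>X. x \<noteq> y \<and> (\<forall>k. x k \<noteq> y k \<longrightarrow> 0 \<le> real_vec k \<bullet> v))"
proof -
  have "(\<forall>k. real_vec k \<in> open_half_space v \<longrightarrow> x k = y k) \<longleftrightarrow> (\<forall>k. x k \<noteq> y k \<longrightarrow> 0 \<le> real_vec k \<bullet> v)"
    for x y :: "('a, 'd) config"
    unfolding open_half_space_def mem_Collect_eq by (metis not_le)
  then show ?thesis
    unfolding ND_def deterministic_def by auto
qed

lemma agreeing_pair_imp_ND:
  assumes "agreeing_pair v x y" "norm v = 1"
  shows "v \<in> ND X"
proof -
  have "x \<noteq> y" using assms(1) unfolding agreeing_pair_def by metis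
  then show ?thesis
    using assms unfolding mem_ND_iff agreeing_pair_def by blast
qed

text \<open>The infimum of \<open>real_vec k \<bullet> v\<close> over the disagreements need not be
  attained. Disagreements approaching it are moved to the origin; in a limit of the translated pairs
  no disagreement has a negative pairing.\<close>

lemma ND_imp_agreeing_pair:
  assumes "v \<in> ND X"
  shows "\<exists>x y. agreeing_pair v x y"
proof -
  obtain x y where x: "x \<in> X" and y: "y \<in> X" and neq: "x \<noteq> y"
    and pos: "\<And>k. x k \<noteq> y k \<Longrightarrow> 0 \<le> real_vec k \<bullet> v"
    using assms unfolding mem_ND_iff by blast
  define S where "S = (\<lambda>k. real_vec k \<bullet> v) ` {k. x k \<noteq> y k}"
  have S: "S \<noteq> {}" "bdd_below S"
    using neq pos by (auto simp: S_def fun_eq_iff intro!: bdd_belowI)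
  have "\<exists>p. x p \<noteq> y p \<and> real_vec p \<bullet> v < Inf S + 1 / real (Suc j)" for j
    using cInf_lessD[OF S(1), of "Inf S + 1 / real (Suc j)"] by (auto simp: S_def)
  then have "\<forall>j. \<exists>p. x p \<noteq> y p \<and> real_vec p \<bullet> v < Inf S + 1 / real (Suc j)" by blast
  from choice[OF this] obtain p where p: "\<forall>j. x (p j) \<noteq> y (p j) \<and> real_vec (p j) \<bullet> v < Inf S + 1 / real (Suc j)" ..
  define s where "s j k = (shift (p j) x k, shift (p j) y k)" for j k
  obtain r t where r: "strict_mono r"
    and t: "\<And>P. finite P \<Longrightarrow> \<forall>\<^sub>F j in sequentially. \<forall>k\<in>P. s (r j) k = t k"
    using convergent_subsequence_of_configs[of s] by blast
  define t1 where "t1 k = fst (t k)" for k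
  define t2 where "t2 k = snd (t k)" for k
  have t1: "\<forall>\<^sub>F j in sequentially. \<forall>k\<in>P. shift (p (r j)) x k = t1 k" if "finite P" for P
    using t[OF that] by eventually_elim (auto simp: s_def t1_def prod_eq_iff)
  have t2: "\<forall>\<^sub>F j in sequentially. \<forall>k\<in>P. shift (p (r j)) y k = t2 k" if "finite P" for P
    using t[OF that] by eventually_elim (auto simp: s_def t2_def prod_eq_iff)
  have X: "t1 \<in> X" "t2 \<in> X"
    using limit_in_X_sequentially[of "\<lambda>j. shift (p (r j)) x" t1]
      limit_in_X_sequentially[of "\<lambda>j. shift (p (r j)) y" t2] t1 t2 shift_in_X x y by blast+
  have lim: "\<forall>\<^sub>F j in sequentially. x (p (r j) + k) = t1 k \<and> y (p (r j) + k) = t2 k" for k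
    using t1[of "{k}"] t2[of "{k}"] by (auto simp: shift_apply elim: eventually_elim2)
  have "t1 0 \<noteq> t2 0"
  proof -
    obtain j where "x (p (r j) + 0) = t1 0 \<and> y (p (r j) + 0) = t2 0"
      using lim[of 0] by (auto simp: eventually_sequentially)
    then show ?thesis using p by (metis add.right_neutral)
  qed
  moreover have "0 \<le> real_vec k \<bullet> v" if neq: "t1 k \<noteq> t2 k" for k
  proof (rule tendsto_lowerbound)
    show "(\<lambda>j. real_vec k \<bullet> v + 1 / real (Suc (r j))) \<longlonglongrightarrow> real_vec k \<bullet> v"
    proof -
      have "(\<lambda>j. 1 / real (Suc (r j))) \<longlonglongrightarrow> 0"
        using LIMSEQ_subseq_LIMSEQ[OF LIMSEQ_inverse_real_of_nat r] by (simp add: o_def inverse_eq_divide)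
      from tendsto_add[OF tendsto_const this] show ?thesis by simp
    qed
    show "\<forall>\<^sub>F j in sequentially. 0 \<le> real_vec k \<bullet> v + 1 / real (Suc (r j))"
      using lim[of k]
    proof eventually_elim
      case (elim j)
      then have "x (p (r j) + k) \<noteq> y (p (r j) + k)" using neq by simp
      then have "real_vec (p (r j) + k) \<bullet> v \<in> S" by (auto simp: S_def)
      then have "Inf S \<le> real_vec (p (r j) + k) \<bullet> v" by (rule cInf_lower[OF _ S(2)])
      also have "\<dots> = real_vec (p (r j)) \<bullet> v + real_vec k \<bullet> v" by (simp add: real_vec_add inner_add_left)
      finally show ?case using p[rule_format, of "r j"] by linarith
    qed
  qed simp
  ultimately show ?thesis using X unfolding agreeing_pair_def by blast
qed

end

section \<open>Desubstituting agreeing pairs and changing the direction\<close>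

context permutative_constant_shape
begin

lemma desubstitute_pair:
  assumes pair: "agreeing_pair v x y" and v: "v \<noteq> 0"
  shows "\<exists>f\<in>minimizers F1 v. \<exists>x' y'. agreeing_pair (pull v) x' y' \<and>
    x = shift f (subst x') \<and> y = shift f (subst y')"
proof -
  note p = pair[unfolded agreeing_pair_def]
  obtain f x' where x': "f \<in> F1" "x' \<in> X" "x = shift f (subst x')"
    using desubstitute[of x] p by blast
  obtain g y' where y': "g \<in> F1" "y' \<in> X" "y = shift g (subst y')"
    using desubstitute[of y] p by blast
  obtain u where u: "A (real_vec u) \<bullet> v < 0" by (rule ex_lattice_negative[OF v])
  have agree: "shift f (subst x') k = shift g (subst y') k" if "real_vec k \<bullet> v < 0" for k
    using p that unfolding x'(3)[symmetric] y'(3)[symmetric] by (metis not_le)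
  have fg: "g = f"
    using same_offset_on_half_space[OF x'(2) y'(2) x'(1) y'(1) u agree] by simp
  have neq: "x' 0 \<noteq> y' 0"
  proof
    assume "x' 0 = y' 0"
    then have "subst x' (L *v 0 + f) = subst y' (L *v 0 + f)" using subst_mult_add[OF x'(1)] by metis
    then show False using p by (simp add: x'(3) y'(3) fg shift_apply)
  qed
  obtain e where e: "e \<in> F1" "bij (\<lambda>a. the (\<zeta> a e))" "\<And>h. h \<in> F1 \<Longrightarrow> v \<bullet> real_vec e \<le> v \<bullet> real_vec h"
    using ex_permutative_minimizer[of v] by blast
  \<comment> \<open>Permutativity at \<open>e\<close> turns a disagreement of the preimages at
    \<open>k\<close> into one of \<open>x\<close> and \<open>y\<close> at
    \<open>L *v k + e - f\<close>. For \<open>k = 0\<close> this forces \<open>f\<close> to be as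
    small for \<open>v\<close> as \<open>e\<close>; the correction term then vanishes and the bound
    says that the preimages agree on the half space of \<open>pull v\<close>.\<close>
  have D: "0 \<le> real_vec k \<bullet> pull v + (v \<bullet> real_vec e - v \<bullet> real_vec f)" if "x' k \<noteq> y' k" for k
  proof -
    have "subst x' (L *v k + e) \<noteq> subst y' (L *v k + e)"
      using that inj_eq[OF bij_is_inj[OF e(2)]] by (simp add: subst_mult_add[OF e(1)])
    then have "x (L *v k + e - f) \<noteq> y (L *v k + e - f)"
      by (simp add: x'(3) y'(3) fg shift_apply)
    then have "0 \<le> real_vec (L *v k + e - f) \<bullet> v" using p by blast
    then show ?thesis
      by (simp add: real_vec_add real_vec_diff inner_add_right inner_diff_right inner_pull_real_vec
          inner_commute[of _ v])
  qed
  have ef: "v \<bullet> real_vec e = v \<bullet> real_vec f"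
    using D[OF neq] e(3)[OF x'(1)] by simp
  then have "f \<in> minimizers F1 v" unfolding minimizers_def using x'(1) e(3) by simp
  moreover have "agreeing_pair (pull v) x' y'"
    using D x'(2) y'(2) neq unfolding agreeing_pair_def ef by simp
  ultimately show ?thesis using x'(3) y'(3) unfolding fg by blast
qed

lemma agreeing_pair_change_direction:
  assumes pair: "agreeing_pair v x y" and v: "v \<noteq> 0"
    and vw: "\<And>n. minimizers F1 ((pull ^^ n) v) \<subseteq> minimizers F1 ((pull ^^ n) w)"
  shows "agreeing_pair w x y"
proof -
  have "\<exists>s. \<forall>n. agreeing_pair ((pull ^^ n) v) (fst (s n)) (snd (s n)) \<and> (n = 0 \<longrightarrow> s n = (x, y)) \<and>
    (\<exists>f\<in>minimizers F1 ((pull ^^ n) v). fst (s n) = shift f (subst (fst (s (Suc n)))) \<and>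
       snd (s n) = shift f (subst (snd (s (Suc n)))))"
    (is "\<exists>s. \<forall>n. ?P n (s n) \<and> (?Z n (s n)) \<and> ?Q n (s n) (s (Suc n))")
  proof -
    have "\<exists>s. \<forall>n. (?P n (s n) \<and> ?Z n (s n)) \<and> ?Q n (s n) (s (Suc n))"
    proof (rule dependent_nat_choice)
      show "\<exists>p. ?P 0 p \<and> ?Z 0 p" using pair by (intro exI[of _ "(x, y)"]) simp
      fix p n assume "?P n p \<and> ?Z n p"
      then obtain f x' y' where "f \<in> minimizers F1 ((pull ^^ n) v)" "agreeing_pair (pull ((pull ^^ n) v)) x' y'"
        "fst p = shift f (subst x')" "snd p = shift f (subst y')"
        using desubstitute_pair pull_funpow_nonzero[OF v] by blast
      then show "\<exists>q. (?P (Suc n) q \<and> ?Z (Suc n) q) \<and> ?Q n p q"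
        by (intro exI[of _ "(x', y')"]) auto
    qed
    then show ?thesis by (simp only: conj_assoc)
  qed
  then obtain s where s: "\<And>n. ?P n (s n)" "\<And>n. ?Z n (s n)" "\<And>n. ?Q n (s n) (s (Suc n))" by blast
  have "\<forall>n. \<exists>f. f \<in> minimizers F1 ((pull ^^ n) v) \<and> fst (s n) = shift f (subst (fst (s (Suc n)))) \<and>
       snd (s n) = shift f (subst (snd (s (Suc n))))"
    using s(3) by blast
  from choice[OF this] obtain f where f: "\<And>n. f n \<in> minimizers F1 ((pull ^^ n) v)"
    "\<And>n. fst (s n) = shift (f n) (subst (fst (s (Suc n))))"
    "\<And>n. snd (s n) = shift (f n) (subst (snd (s (Suc n))))" by blast
  have fF1: "f n \<in> F1" for n using f(1)[of n] by (simp add: minimizers_def)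
  obtain M where M: "\<And>h. h \<in> F1 \<Longrightarrow> norm (real_vec h) \<le> M" "0 \<le> M"
  proof -
    have "norm (real_vec h) \<le> Max (insert 0 ((\<lambda>h. norm (real_vec h)) ` F1))" if "h \<in> F1" for h
      using finite_F1 that by (intro Max_ge) auto
    moreover have "0 \<le> Max (insert 0 ((\<lambda>h. norm (real_vec h)) ` F1))"
      using finite_F1 by (intro Max_ge) auto
    ultimately show thesis using that by blast
  qed
  have "0 \<le> real_vec p \<bullet> w" if p: "x p \<noteq> y p" for p
  proof -
    \<comment> \<open>\<open>g n\<close> is the ancestor of \<open>p\<close> after \<open>n\<close>
      desubstitutions; equal letters at an ancestor would give equal letters below it, so the
      disagreement is inherited.\<close>
    define g where "g = rec_nat p (\<lambda>n q. Q (f n + q))"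
    define h where "h n = R (f n + g n)" for n
    have g0: "g 0 = p" and gSuc: "g (Suc n) = Q (f n + g n)" for n
      by (simp_all add: g_def)
    have hF1: "h n \<in> F1" for n by (simp add: h_def R_in_F1)
    have gh: "real_vec (g n) = A (real_vec (g (Suc n))) + real_vec (h n - f n)" for n
      using Q_R[of "f n + g n"] unfolding gSuc h_def real_matrix_mult_real_vec
      by (simp add: real_vec_add[symmetric] algebra_simps)
    have diff: "fst (s n) (g n) \<noteq> snd (s n) (g n)" for n
    proof (induction n)
      case 0
      show ?case using p s(2)[of 0] by (simp add: g0)
    next
      case (Suc n)
      show ?case
      proof
        assume "fst (s (Suc n)) (g (Suc n)) = snd (s (Suc n)) (g (Suc n))"
        then have "subst (fst (s (Suc n))) (f n + g n) = subst (snd (s (Suc n))) (f n + g n)"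
          unfolding subst_apply gSuc by simp
        then have "fst (s n) (g n) = snd (s n) (g n)"
          unfolding f(2,3)[of n] shift_apply .
        then show False using Suc by contradiction
      qed
    qed
    define c where "c n = real_vec (g n) \<bullet> (pull ^^ n) v" for n
    define d where "d n = real_vec (g n) \<bullet> (pull ^^ n) w" for n
    have c_pos: "0 \<le> c n" for n
      using s(1)[of n] diff[of n] unfolding agreeing_pair_def c_def by blast
    have c_step: "c n = c (Suc n) + real_vec (h n - f n) \<bullet> (pull ^^ n) v" for n
      unfolding c_def gh[of n] by (simp add: inner_add_left inner_pull)
    have d_step: "d n = d (Suc n) + real_vec (h n - f n) \<bullet> (pull ^^ n) w" for n
      unfolding d_def gh[of n] by (simp add: inner_add_left inner_pull)
    have c_dec: "c (Suc n) \<le> c n" for n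
      using c_step[of n] minimizers_nonneg[OF f(1) hF1] by simp
    have "f n \<in> minimizers F1 ((pull ^^ n) w)" for n using vw f(1) by blast
    then have d_dec: "d (Suc n) \<le> d n" for n
      using d_step[of n] minimizers_nonneg[OF _ hF1] by simp
    \<comment> \<open>Chosen so that the ball of radius \<open>norm (real_vec p) + K\<close> is
      invariant: writing q for \<open>contraction\<close>, q(K + 2M) = K - K(1-q)^2, which is at
      most K.\<close>
    define K where "K = 2 * M / (1 - contraction)"
    have K: "2 * M = K * (1 - contraction)" "0 \<le> K"
      using contraction(2) M(2) by (simp_all add: K_def)
    have bound: "norm (real_vec (g n)) \<le> norm (real_vec p) + K" for n
    proof (induction n)
      case 0
      show ?case using K(2) by (simp add: g0)
    next
      case (Suc n)
      have "A (real_vec (g (Suc n))) = real_vec (g n) - (real_vec (h n) - real_vec (f n))"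
        using gh[of n] by (simp add: real_vec_diff)
      then have "norm (A (real_vec (g (Suc n)))) \<le> norm (real_vec (g n)) + (norm (real_vec (h n)) + norm (real_vec (f n)))"
        using norm_triangle_ineq4[of "real_vec (g n)" "real_vec (h n) - real_vec (f n)"]
          norm_triangle_ineq4[of "real_vec (h n)" "real_vec (f n)"] by simp
      also have "\<dots> \<le> norm (real_vec p) + K + 2 * M"
        using Suc M(1)[OF hF1[of n]] M(1)[OF fF1[of n]] by simp
      finally have "norm (real_vec (g (Suc n))) \<le> contraction * (norm (real_vec p) + K + 2 * M)"
        by (rule order.trans[OF contraction(3) mult_left_mono[OF _ contraction(1)]])
      also have "\<dots> = contraction * norm (real_vec p) + (K - K * (1 - contraction)\<^sup>2)"
        unfolding K(1) by (simp add: algebra_simps power2_eq_square)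
      also have "\<dots> \<le> norm (real_vec p) + K"
        using contraction(1,2) K(2) by (intro add_mono mult_left_le_one_le) auto
      finally show ?case .
    qed
    have "finite (range g)"
      by (rule finite_subset[OF _ finite_norm_real_vec_le]) (use bound in blast)
    then have fin: "finite (range (\<lambda>n. real_vec (g (N + n))))" for N
      by (rule finite_surj[of _ _ real_vec]) auto
    have c_bound: "c n \<le> c 0" for n
      by (induction n) (auto intro: order.trans[OF c_dec])
    have "\<bar>(A ^^ n) (real_vec (g n)) \<bullet> v\<bar> \<le> c 0" for n
      using c_pos[of n] c_bound[of n] by (simp add: inner_pull_funpow[symmetric] c_def[symmetric])
    from bounded_pairings_vanish[OF matrix_vector_mul_linear contraction(3,1,2) _ this]
    obtain N where "(A ^^ N) (real_vec (g N)) \<bullet> v = 0" using fin[of 0] by auto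
    then have cN: "c N = 0" by (simp add: inner_pull_funpow[symmetric] c_def[symmetric])
    \<comment> \<open>A nonnegative nonincreasing sequence stays zero once it vanishes.\<close>
    have c0: "c (N + n) = 0" for n
    proof (induction n)
      case (Suc n)
      then show ?case using c_pos[of "N + Suc n"] c_dec[of "N + n"] by simp
    qed (simp add: cN)
    \<comment> \<open>From time \<open>N\<close> on, the remainder \<open>h\<close> is minimal for
      the pulled back \<open>v\<close>, hence also for the pulled back \<open>w\<close>, just as
      \<open>f\<close> is. So the pairings with \<open>w\<close> no longer change.\<close>
    have dN: "d (N + n) = d N" for n
    proof (induction n)
      case (Suc n)
      have "real_vec (h (N + n) - f (N + n)) \<bullet> (pull ^^ (N + n)) v = 0"
        using c_step[of "N + n"] c0[of n] c0[of "Suc n"] by simp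
      then have "h (N + n) \<in> minimizers F1 ((pull ^^ (N + n)) v)"
        using minimizers_mem_iff[OF f(1) hF1] by blast
      then have "real_vec (h (N + n) - f (N + n)) \<bullet> (pull ^^ (N + n)) w = 0"
        using minimizers_mem_iff[of "f (N + n)" F1 _ "h (N + n)"] vw f(1) hF1 by blast
      then show ?case using d_step[of "N + n"] Suc by simp
    qed simp
    have dA: "(A ^^ n) (real_vec (g (N + n))) \<bullet> (pull ^^ N) w = d (N + n)" for n
      unfolding inner_pull_funpow[symmetric] d_def by (simp add: funpow_add add.commute[of N n])
    then have "\<bar>(A ^^ n) (real_vec (g (N + n))) \<bullet> (pull ^^ N) w\<bar> \<le> \<bar>d N\<bar>" for n
      by (simp add: dN)
    \<comment> \<open>No sign of \<open>d\<close> is known beforehand, but an eventually constant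
      \<open>d\<close> is bounded, so that constant is zero; monotonicity then gives
      \<open>0 \<le> d 0\<close>.\<close>
    from bounded_pairings_vanish[OF matrix_vector_mul_linear contraction(3,1,2) fin this]
    have "d N = 0" unfolding dA dN by blast
    moreover have "d n \<le> d 0" for n
      by (induction n) (auto intro: order.trans[OF d_dec])
    ultimately have "0 \<le> d 0" by metis
    then show ?thesis by (simp add: d_def g0)
  qed
  then show ?thesis using pair unfolding agreeing_pair_def by blast
qed

end

section \<open>Opposite normal cones of the supports\<close>

lemma mem_opposite_normal_cone_iff:
  "w \<in> opposite_normal_cone C G \<longleftrightarrow> (\<forall>p\<in>G. p \<in> C \<and> (\<forall>t\<in>C. w \<bullet> p \<le> w \<bullet> t))"
  unfolding opposite_normal_cone_def is_arg_min_def by (auto simp: not_less)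

text \<open>The face where \<open>v\<close> is minimal is the hull of the points of \<open>F\<close>
  on it, so minimality of \<open>w\<close> on the face can be tested at those points. Cones thereby
  become inclusions between finite sets of minimizers.\<close>

lemma ex_face_opposite_normal_cone:
  fixes F :: "(int^'d::finite) set" and v :: "real^'d"
  assumes "finite F" "F \<noteq> {}"
  shows "\<exists>G. G \<noteq> {} \<and> G face_of (convex hull (real_vec ` F)) \<and>
    opposite_normal_cone (convex hull (real_vec ` F)) G = {w. minimizers F v \<subseteq> minimizers F w}"
proof -
  let ?H = "convex hull (real_vec ` F)"
  obtain e where e: "e \<in> F" "\<And>f. f \<in> F \<Longrightarrow> v \<bullet> real_vec e \<le> v \<bullet> real_vec f"
    using ex_minimizing_vertex[OF assms, where v = v] by blast
  define G where "G = ?H \<inter> {x. v \<bullet> x = v \<bullet> real_vec e}"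
  have ge: "?H \<subseteq> {x. v \<bullet> x \<ge> v \<bullet> real_vec e}"
    using e(2) by (intro hull_minimal convex_halfspace_ge) auto
  then have face: "G face_of ?H"
    unfolding G_def by (intro face_of_Int_supporting_hyperplane_ge convex_convex_hull) auto
  have vert: "real_vec f \<in> G \<longleftrightarrow> f \<in> minimizers F v" if "f \<in> F" for f
  proof -
    have "real_vec f \<in> ?H" using that by (intro hull_inc) auto
    then show ?thesis
      using e that unfolding G_def minimizers_def by (auto intro: order.antisym)
  qed
  obtain S where S: "S \<subseteq> real_vec ` F" "G = convex hull S"
    using face_of_convex_hull_subset[OF finite_imp_compact face] assms(1) by blast
  have "w \<in> opposite_normal_cone ?H G \<longleftrightarrow> minimizers F v \<subseteq> minimizers F w" for w
  proof
    assume w: "w \<in> opposite_normal_cone ?H G"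
    show "minimizers F v \<subseteq> minimizers F w"
    proof
      fix f assume f: "f \<in> minimizers F v"
      then have fF: "f \<in> F" by (simp add: minimizers_def)
      then have "\<forall>t\<in>?H. w \<bullet> real_vec f \<le> w \<bullet> t"
        using w vert f unfolding mem_opposite_normal_cone_iff by blast
      moreover have "real_vec h \<in> ?H" if "h \<in> F" for h using that by (intro hull_inc) auto
      ultimately show "f \<in> minimizers F w" using fF by (simp add: minimizers_def)
    qed
  next
    assume sub: "minimizers F v \<subseteq> minimizers F w"
    have "e \<in> minimizers F v" using e by (simp add: minimizers_def)
    then have e_min: "w \<bullet> real_vec e \<le> w \<bullet> real_vec h" if "h \<in> F" for h
      using sub that by (auto simp: minimizers_def)
    then have low: "?H \<subseteq> {x. w \<bullet> x \<ge> w \<bullet> real_vec e}"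
      by (intro hull_minimal convex_halfspace_ge) auto
    have "S \<subseteq> {x. w \<bullet> x = w \<bullet> real_vec e}"
    proof
      fix s assume s: "s \<in> S"
      then obtain f where f: "f \<in> F" "s = real_vec f" using S(1) by blast
      have "s \<in> G" using s S(2) by (simp add: hull_inc)
      then have "f \<in> minimizers F w" using vert[OF f(1)] f(2) sub by blast
      then have "w \<bullet> real_vec f \<le> w \<bullet> real_vec e" using e(1) by (simp add: minimizers_def)
      then show "s \<in> {x. w \<bullet> x = w \<bullet> real_vec e}" using e_min[OF f(1)] f(2) by simp
    qed
    then have on: "G \<subseteq> {x. w \<bullet> x = w \<bullet> real_vec e}"
      unfolding S(2) by (intro hull_minimal convex_hyperplane)
    show "w \<in> opposite_normal_cone ?H G"
      unfolding mem_opposite_normal_cone_iff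
    proof (intro ballI conjI)
      fix p assume p: "p \<in> G"
      then show "p \<in> ?H" unfolding G_def by blast
      fix t assume "t \<in> ?H"
      then have "w \<bullet> real_vec e \<le> w \<bullet> t" using low by blast
      moreover have "w \<bullet> p = w \<bullet> real_vec e" using p on by blast
      ultimately show "w \<bullet> p \<le> w \<bullet> t" by simp
    qed
  qed
  moreover have "G \<noteq> {}" using vert[OF e(1)] e by (auto simp: minimizers_def)
  ultimately show ?thesis using face by blast
qed

context constant_shape
begin

lemma finite_supports: "finite (supports L F1 n)"
proof (induction n)
  case (Suc n)
  have "supports L F1 (Suc n) = (\<lambda>(f, g). f + L *v g) ` (F1 \<times> supports L F1 n)" by auto
  then show ?case using Suc finite_F1 by simp
qed simp

lemma zero_in_supports: "0 \<in> supports L F1 n"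
proof (induction n)
  case (Suc n)
  then have "0 = 0 + L *v 0 \<and> 0 \<in> F1 \<and> 0 \<in> supports L F1 n" using zero_in_F1 by simp
  then show ?case unfolding supports.simps by blast
qed simp

lemma minimizers_nonempty:
  assumes "finite F" "0 \<in> F"
  shows "minimizers F v \<noteq> {}"
proof -
  have ne: "F \<noteq> {}" using assms(2) by blast
  obtain e where "e \<in> F" "\<And>f. f \<in> F \<Longrightarrow> v \<bullet> real_vec e \<le> v \<bullet> real_vec f"
    using ex_minimizing_vertex[OF assms(1) ne, where v = v] by blast
  then show ?thesis unfolding minimizers_def by blast
qed

lemma inner_real_vec_add_mult:
  "v \<bullet> real_vec (f + L *v g) = v \<bullet> real_vec f + pull v \<bullet> real_vec g"
proof -
  have "v \<bullet> real_vec (L *v g) = pull v \<bullet> real_vec g"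
    using inner_pull_real_vec[of g v] by (metis inner_commute)
  then show ?thesis by (simp add: real_vec_add inner_add_right)
qed

text \<open>The pairing of \<open>v\<close> with \<open>f + L *v g\<close> splits into a term in
  \<open>f\<close> and the pairing of \<open>pull v\<close> with \<open>g\<close>, so the two
  summands are minimized independently.\<close>

lemma minimizers_supports_Suc:
  assumes f: "f \<in> F1" and g: "g \<in> supports L F1 n"
  shows "f + L *v g \<in> minimizers (supports L F1 (Suc n)) v \<longleftrightarrow>
    f \<in> minimizers F1 v \<and> g \<in> minimizers (supports L F1 n) (pull v)"
proof
  assume min: "f + L *v g \<in> minimizers (supports L F1 (Suc n)) v"
  then have le: "v \<bullet> real_vec (f + L *v g) \<le> v \<bullet> real_vec (f' + L *v g')"
    if "f' \<in> F1" "g' \<in> supports L F1 n" for f' g'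
    using that unfolding minimizers_def by auto
  have "v \<bullet> real_vec f \<le> v \<bullet> real_vec f'" if "f' \<in> F1" for f'
    using le[OF that g] by (simp add: inner_real_vec_add_mult)
  moreover have "pull v \<bullet> real_vec g \<le> pull v \<bullet> real_vec g'" if "g' \<in> supports L F1 n" for g'
    using le[OF f that] by (simp add: inner_real_vec_add_mult)
  ultimately show "f \<in> minimizers F1 v \<and> g \<in> minimizers (supports L F1 n) (pull v)"
    using f g by (simp add: minimizers_def)
next
  assume min: "f \<in> minimizers F1 v \<and> g \<in> minimizers (supports L F1 n) (pull v)"
  have "v \<bullet> real_vec (f + L *v g) \<le> v \<bullet> real_vec k" if "k \<in> supports L F1 (Suc n)" for k
    using that min by (auto simp: inner_real_vec_add_mult minimizers_def intro!: add_mono)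
  then show "f + L *v g \<in> minimizers (supports L F1 (Suc n)) v"
    using f g unfolding minimizers_def by auto
qed

text \<open>The refinement property of the normal fans. An inclusion between sums of minimizers
  splits into inclusions of the summands because the sets of minimizers are nonempty and
  decompositions can be compared summand by summand.\<close>

lemma minimizers_supports_subset_iff:
  "minimizers (supports L F1 n) v \<subseteq> minimizers (supports L F1 n) w \<longleftrightarrow>
    (\<forall>j<n. minimizers F1 ((pull ^^ j) v) \<subseteq> minimizers F1 ((pull ^^ j) w))"
proof (induction n arbitrary: v w)
  case 0
  show ?case by (auto simp: minimizers_def)
next
  case (Suc n)
  have "minimizers (supports L F1 (Suc n)) v \<subseteq> minimizers (supports L F1 (Suc n)) w \<longleftrightarrow>
    minimizers F1 v \<subseteq> minimizers F1 w \<and>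
    minimizers (supports L F1 n) (pull v) \<subseteq> minimizers (supports L F1 n) (pull w)" (is "?l \<longleftrightarrow> ?r")
  proof
    assume l: ?l
    have both: "f \<in> minimizers F1 w \<and> g \<in> minimizers (supports L F1 n) (pull w)"
      if "f \<in> minimizers F1 v" "g \<in> minimizers (supports L F1 n) (pull v)" for f g
    proof -
      have fg: "f \<in> F1" "g \<in> supports L F1 n" using that by (auto simp: minimizers_def)
      then show ?thesis using l that minimizers_supports_Suc[OF fg] by blast
    qed
    then show ?r
      using minimizers_nonempty[OF finite_F1 zero_in_F1, of v]
        minimizers_nonempty[OF finite_supports zero_in_supports, of n "pull v"] by blast
  next
    assume r: ?r
    show ?l
    proof
      fix k assume k: "k \<in> minimizers (supports L F1 (Suc n)) v"
      then obtain f g where fg: "f \<in> F1" "g \<in> supports L F1 n" and "k = f + L *v g"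
        by (auto simp: minimizers_def)
      then show "k \<in> minimizers (supports L F1 (Suc n)) w"
        using k r minimizers_supports_Suc[OF fg] by blast
    qed
  qed
  then show ?case
    unfolding All_less_Suc2 Suc funpow_Suc_right comp_apply by simp
qed

text \<open>By the Folner property a late support contains, for every axis, two points differing by
  the unit vector. A functional constant on its hull is therefore zero, and the hull is taken as a
  face of itself.\<close>

lemma ex_trivial_opposite_normal_cone:
  assumes "folner (supports L F1)"
  shows "\<exists>n>0. opposite_normal_cone (convex hull (real_vec ` supports L F1 n))
    (convex hull (real_vec ` supports L F1 n)) = {0}"
proof -
  let ?F = "supports L F1"
  have "\<forall>\<^sub>F n in sequentially. \<exists>k\<in>?F n. axis i 1 + k \<in> ?F n" for i
  proof -
    let ?m = "axis i 1 :: int^'d"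
    have "(\<lambda>n. real (card (sym_diff (?F n) ((+) ?m ` ?F n))) / real (card (?F n))) \<longlonglongrightarrow> 0"
      using assms unfolding folner_def by blast
    \<comment> \<open>If the support were disjoint from its translate, the ratio would be exactly
      2.\<close>
    then have "\<forall>\<^sub>F n in sequentially. real (card (sym_diff (?F n) ((+) ?m ` ?F n))) / real (card (?F n)) < 2"
      by (rule order_tendstoD) simp
    then show ?thesis
    proof eventually_elim
      case (elim n)
      show ?case
      proof (rule ccontr)
        assume "\<not> ?thesis"
        then have disj: "?F n \<inter> (+) ?m ` ?F n = {}" by auto
        then have "sym_diff (?F n) ((+) ?m ` ?F n) = ?F n \<union> (+) ?m ` ?F n" by blast
        then have "card (sym_diff (?F n) ((+) ?m ` ?F n)) = card (?F n) + card ((+) ?m ` ?F n)"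
          using card_Un_disjoint[OF finite_supports finite_imageI[OF finite_supports] disj] by simp
        also have "card ((+) ?m ` ?F n) = card (?F n)" by (simp add: card_image)
        finally have "card (sym_diff (?F n) ((+) ?m ` ?F n)) = 2 * card (?F n)" by simp
        moreover have "card (?F n) > 0"
          using finite_supports zero_in_supports card_gt_0_iff by blast
        ultimately show False using elim by simp
      qed
    qed
  qed
  then have "\<forall>\<^sub>F n in sequentially. \<forall>i. \<exists>k\<in>?F n. axis i 1 + k \<in> ?F n"
    by (intro eventually_all_finite)
  then have "\<forall>\<^sub>F n in sequentially. n > 0 \<and> (\<forall>i. \<exists>k\<in>?F n. axis i 1 + k \<in> ?F n)"
    using eventually_gt_at_top[of 0] by eventually_elim blast
  then obtain n where n: "n > 0" "\<And>i. \<exists>k\<in>?F n. axis i 1 + k \<in> ?F n"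
    by (auto simp: eventually_sequentially)
  let ?H = "convex hull (real_vec ` ?F n)"
  have "w = 0" if w: "w \<in> opposite_normal_cone ?H ?H" for w
  proof -
    have const: "w \<bullet> real_vec k = w \<bullet> real_vec h" if "k \<in> ?F n" "h \<in> ?F n" for k h
    proof -
      have "real_vec k \<in> ?H" "real_vec h \<in> ?H" using that by (auto intro: hull_inc)
      then show ?thesis using w unfolding mem_opposite_normal_cone_iff by (meson order.antisym)
    qed
    have "w $ i = 0" for i
    proof -
      obtain k where "k \<in> ?F n" "axis i 1 + k \<in> ?F n" using n(2) by blast
      then have "w \<bullet> real_vec (axis i 1 + k) = w \<bullet> real_vec k" by (intro const)
      moreover have "real_vec (axis i 1) = axis i 1"
        by (simp add: real_vec_def axis_def vec_eq_iff)
      ultimately show ?thesis by (simp add: real_vec_add inner_add_right inner_axis)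
    qed
    then show ?thesis by (simp add: vec_eq_iff)
  qed
  moreover have "0 \<in> opposite_normal_cone ?H ?H" unfolding mem_opposite_normal_cone_iff by simp
  ultimately show ?thesis using n(1) by blast
qed

text \<open>Stage \<open>i\<close> belongs to the support with index \<open>Suc i\<close>, which
  keeps the index positive. Expressed through minimizers in \<open>F1\<close>, the sequence is
  visibly decreasing.\<close>

definition nested_cone :: "real^'d \<Rightarrow> nat \<Rightarrow> (real^'d) set" where
  "nested_cone v i = {w. \<forall>j<Suc i. minimizers F1 ((pull ^^ j) v) \<subseteq> minimizers F1 ((pull ^^ j) w)}"

lemma decseq_nested_cone: "decseq (nested_cone v)"
proof (rule decseq_SucI)
  show "nested_cone v (Suc i) \<subseteq> nested_cone v i" for i
    unfolding nested_cone_def using less_SucI by blast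
qed

lemma nested_cone_eq_opposite_normal_cone:
  "\<exists>n>0. \<exists>G. G \<noteq> {} \<and> G face_of (convex hull (real_vec ` supports L F1 n)) \<and>
     nested_cone v i = opposite_normal_cone (convex hull (real_vec ` supports L F1 n)) G"
proof -
  have "supports L F1 (Suc i) \<noteq> {}" using zero_in_supports by blast
  from ex_face_opposite_normal_cone[OF finite_supports this, of v]
  show ?thesis
    unfolding minimizers_supports_subset_iff nested_cone_def by (metis zero_less_Suc)
qed

end

section \<open>The family of limit cones\<close>

theorem theorem5p2:
  fixes L :: "int^'d^'d"
    and F1 :: "(int^'d) set"
    and \<zeta> :: "'a::finite \<Rightarrow> ('a, 'd::finite) pattern"
  assumes "constant_shape_substitution L F1 \<zeta>"
    and "folner (supports L F1)"
    and "primitive L F1 \<zeta>"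
    and "aperiodic (subst_subshift L F1 \<zeta>)"
    and "extremally_permutative F1 \<zeta>"
  shows "\<exists>\<C> :: (real^'d) set set.
    \<C> \<noteq> {} \<and>
    (\<forall>C\<in>\<C>. \<exists>K :: nat \<Rightarrow> (real^'d) set.
       decseq K \<and>
       (\<forall>i. \<exists>n>0. \<exists>G. G \<noteq> {} \<and>
          G face_of (convex hull (real_vec ` supports L F1 n)) \<and>
          K i = opposite_normal_cone (convex hull (real_vec ` supports L F1 n)) G) \<and>
       C = (\<Inter>i. K i)) \<and>
    ND (subst_subshift L F1 \<zeta>) = sphere 0 1 \<inter> \<Union>\<C>"
proof -
  interpret permutative_constant_shape L F1 \<zeta>
    using assms by unfold_locales
  let ?cone = "\<lambda>v. \<Inter>i. nested_cone v i"
  let ?nested = "\<lambda>C. \<exists>K :: nat \<Rightarrow> (real^'d) set.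
       decseq K \<and>
       (\<forall>i. \<exists>n>0. \<exists>G. G \<noteq> {} \<and>
          G face_of (convex hull (real_vec ` supports L F1 n)) \<and>
          K i = opposite_normal_cone (convex hull (real_vec ` supports L F1 n)) G) \<and>
       C = (\<Inter>i. K i)"
  have "?nested (?cone v)" for v
    by (rule exI[of _ "nested_cone v"], intro conjI allI decseq_nested_cone nested_cone_eq_opposite_normal_cone refl)
  \<comment> \<open>The constant sequence with value \<open>{0}\<close> is nested, and its limit
    \<open>{0}\<close> does not meet the unit sphere.\<close>
  moreover have "?nested {0}"
  proof -
    obtain n where n: "n > 0" "opposite_normal_cone (convex hull (real_vec ` supports L F1 n))
      (convex hull (real_vec ` supports L F1 n)) = {0}"
      using ex_trivial_opposite_normal_cone[OF assms(2)] by blast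
    have "convex hull (real_vec ` supports L F1 n) \<noteq> {}"
      using zero_in_supports by (metis convex_hull_eq_empty empty_iff image_is_empty)
    then have "\<exists>n>0. \<exists>G. G \<noteq> {} \<and> G face_of (convex hull (real_vec ` supports L F1 n)) \<and>
        {0} = opposite_normal_cone (convex hull (real_vec ` supports L F1 n)) G"
      using n face_of_refl[OF convex_convex_hull] by metis
    then show ?thesis
      by (intro exI[of _ "\<lambda>_. {0}"]) auto
  qed
  ultimately have nested: "\<forall>C\<in>insert {0} (?cone ` ND X). ?nested C" by blast
  have self: "v \<in> ?cone v" for v by (simp add: nested_cone_def)
  have ND_cone: "w \<in> ND X" if v: "v \<in> ND X" and w: "w \<in> ?cone v" "norm w = 1" for v w
  proof -
    have "minimizers F1 ((pull ^^ n) v) \<subseteq> minimizers F1 ((pull ^^ n) w)" for n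
      using w(1) unfolding nested_cone_def by blast
    moreover obtain x y where "agreeing_pair v x y" using ND_imp_agreeing_pair[OF v] by blast
    moreover have "v \<noteq> 0" using v unfolding mem_ND_iff by auto
    ultimately show ?thesis
      using agreeing_pair_change_direction agreeing_pair_imp_ND w(2) by blast
  qed
  have "ND X = sphere 0 1 \<inter> \<Union>(insert {0} (?cone ` ND X))"
  proof
    show "ND X \<subseteq> sphere 0 1 \<inter> \<Union>(insert {0} (?cone ` ND X))"
    proof
      fix v assume v: "v \<in> ND X"
      then have "v \<in> sphere 0 1" unfolding mem_ND_iff by simp
      then show "v \<in> sphere 0 1 \<inter> \<Union>(insert {0} (?cone ` ND X))" using v self by blast
    qed
    show "sphere 0 1 \<inter> \<Union>(insert {0} (?cone ` ND X)) \<subseteq> ND X"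
    proof
      fix w assume "w \<in> sphere 0 1 \<inter> \<Union>(insert {0} (?cone ` ND X))"
      then have "norm w = 1" "w = 0 \<or> (\<exists>v\<in>ND X. w \<in> ?cone v)" by auto
      then show "w \<in> ND X" using ND_cone by auto
    qed
  qed
  then show ?thesis
    using nested by (intro exI[of _ "insert {0} (?cone ` ND X)"] conjI) auto
qed

end
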